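(* Let $G$ be a group with finite presentation $G=\langle s_1,\dots,s_m\mid r_1,\dots,r_n\rangle$. Then for every vertex $x$ of the graph $X_{\langle S\mid R\rangle}$ one has $A_1(X_{\langle S\mid R\rangle},x)\cong G$.
   Context: Graphs are simple undirected loopless graphs; graph maps send adjacent vertices to equal or adjacent vertices; colimits in $\mathsf{Graph}$: the vertex set of a pushout is the pushout of vertex sets, edges are images of edges whose endpoints remain distinct. $I_n$ has vertices $0,\dots,n$, edges $i\sim i+1$; $C_k$ ($k\ge3$) is the cycle on $\mathbb{Z}/k$ with $i\sim i+1$. The box product $A\square B$ has vertices $V(A)\times V(B)$, $(a,b)\sim(a',b')$ iff ($a\sim a'$, $b=b'$) or ($a=a'$, $b\sim b'$). The cone $\mathsf{Cone}_3(Y)$ is the pushout of $Y\square I_3\leftarrow Y\square I_0\to I_0$ (collapse all $(y,0)$ to one vertex); the disk $D_{k,3}=\mathsf{Cone}_3(C_k)$ with boundary map $\partial_{k,3}\colon C_k\to D_{k,3}$, $i\mapsto(i,3)$. $\bigvee_{i=1}^mC_5$ is the wedge of $m$ copies of $C_5$ glued at the vertex $0$; write $(i,t)$, $t\in\mathbb{Z}/5$, for vertex $t$ of the $i$-th copy. Each relator $r_j$ is a word $s_{i_1}^{d_1}\cdots s_{i_k}^{d_k}$ in the generators; its degree is $\deg(r_j)=|d_1|+\dots+|d_k|$ (assumed $\ge1$). Expanding $r_j$ as a sequence of $N=\deg(r_j)$ letters $s_{a_1}^{\epsilon_1}\cdots s_{a_N}^{\epsilon_N}$ with $\epsilon_l=\pm1$,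 define $\varepsilon_{r_j}\colon C_{5N}\to\bigvee_{i=1}^mC_5$ by $5(l-1)+t\mapsto(a_l,\epsilon_l t\bmod 5)$ for $l=1,\dots,N$, $t=0,\dots,4$ (wrapping once around the $a_l$-th circle, clockwise if $\epsilon_l=1$, counter-clockwise if $\epsilon_l=-1$). The graph $X_{\langle S\mid R\rangle}$ is the pushout of $\coprod_{j=1}^nD_{5\deg(r_j),3}\xleftarrow{\coprod_j\partial_{5\deg(r_j),3}}\coprod_{j=1}^nC_{5\deg(r_j)}\xrightarrow{(\varepsilon_{r_j})_j}\bigvee_{i=1}^mC_5$. $A_1(X,x)$ is the fundamental group: path-homotopy classes of finite loops at $x$ (path-components of the quotient of $\coprod_nP_nX(x,x)$ by reparametrization along surjective order-preserving maps $I_{m'}\to I_n$; $P_nX(x,x)$ has loops $I_n\to X$ as vertices, adjacent iff distinct and pointwise equal-or-adjacent) under concatenation. *)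

theory Defs
  imports "HOL-Algebra.Coset"
begin

section \<open>Graphs and graph maps\<close>

record 'a graph =
  verts :: "'a set"
  adj :: "('a \<times> 'a) set"

definition simple_graph :: "'a graph \<Rightarrow> bool" where
  "simple_graph G \<longleftrightarrow> adj G \<subseteq> verts G \<times> verts G \<and> sym (adj G) \<and> irrefl (adj G)"

definition graph_map :: "'a graph \<Rightarrow> 'b graph \<Rightarrow> ('a \<Rightarrow> 'b) \<Rightarrow> bool" where
  "graph_map G H f \<longleftrightarrow> f ` verts G \<subseteq> verts H \<and>
     (\<forall>u v. (u, v) \<in> adj G \<longrightarrow> f u = f v \<or> (f u, f v) \<in> adj H)"

definition path_graph :: "nat \<Rightarrow> nat graph" where
  "path_graph n = \<lparr>verts = {0..n},
     adj = {(i, j). i \<le> n \<and> j \<le> n \<and> (j = i + 1 \<or> i = j + 1)}\<rparr>"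

text \<open>The residues modulo \<open>k\<close> are represented by \<open>0, \<dots>, k - 1\<close>; meaningful for \<open>k \<ge> 3\<close>.\<close>

definition cycle_graph :: "nat \<Rightarrow> nat graph" where
  "cycle_graph k = \<lparr>verts = {0..<k},
     adj = {(i, j). i < k \<and> j < k \<and> (j = (i + 1) mod k \<or> i = (j + 1) mod k)}\<rparr>"

definition box_product :: "'a graph \<Rightarrow> 'b graph \<Rightarrow> ('a \<times> 'b) graph" where
  "box_product A B = \<lparr>verts = verts A \<times> verts B,
     adj = {((a, b), (a', b')). a \<in> verts A \<and> a' \<in> verts A \<and> b \<in> verts B \<and> b' \<in> verts B \<and>
              ((a, a') \<in> adj A \<and> b = b' \<or> a = a' \<and> (b, b') \<in> adj B)}\<rparr>"

section \<open>Colimits\<close>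

definition graph_sum :: "'a graph \<Rightarrow> 'b graph \<Rightarrow> ('a + 'b) graph" where
  "graph_sum A B = \<lparr>verts = verts A <+> verts B,
     adj = {(Inl u, Inl v) | u v. (u, v) \<in> adj A} \<union> {(Inr u, Inr v) | u v. (u, v) \<in> adj B}\<rparr>"

definition graph_coprod :: "'i set \<Rightarrow> ('i \<Rightarrow> 'a graph) \<Rightarrow> ('i \<times> 'a) graph" where
  "graph_coprod I G = \<lparr>verts = (SIGMA i:I. verts (G i)),
     adj = {((i, u), (i, v)) | i u v. i \<in> I \<and> (u, v) \<in> adj (G i)}\<rparr>"

definition generated_equiv :: "'a set \<Rightarrow> ('a \<times> 'a) set \<Rightarrow> ('a \<times> 'a) set" where
  "generated_equiv V R = {(u, v). u \<in> V \<and> v \<in> V \<and> equivclp (\<lambda>a b. (a, b) \<in> R) u v}"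

definition quotient_map :: "'a graph \<Rightarrow> ('a \<times> 'a) set \<Rightarrow> 'a \<Rightarrow> 'a set" where
  "quotient_map G R u = generated_equiv (verts G) R `` {u}"

definition quotient_graph :: "'a graph \<Rightarrow> ('a \<times> 'a) set \<Rightarrow> 'a set graph" where
  "quotient_graph G R = \<lparr>verts = verts G // generated_equiv (verts G) R,
     adj = {(quotient_map G R u, quotient_map G R v) | u v.
              (u, v) \<in> adj G \<and> quotient_map G R u \<noteq> quotient_map G R v}\<rparr>"

definition gluing :: "'a graph \<Rightarrow> ('a \<Rightarrow> 'b) \<Rightarrow> ('a \<Rightarrow> 'c) \<Rightarrow> (('b + 'c) \<times> ('b + 'c)) set" where
  "gluing A f g = {(Inl (f a), Inr (g a)) | a. a \<in> verts A}"

text \<open>The pushout of \<open>B \<leftarrow> A \<rightarrow> C\<close> along \<open>f\<close> and \<open>g\<close>, and the structure map from \<open>B\<close>.\<close>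

definition pushout ::
    "'a graph \<Rightarrow> 'b graph \<Rightarrow> 'c graph \<Rightarrow> ('a \<Rightarrow> 'b) \<Rightarrow> ('a \<Rightarrow> 'c) \<Rightarrow> ('b + 'c) set graph" where
  "pushout A B C f g = quotient_graph (graph_sum B C) (gluing A f g)"

definition pushout_left ::
    "'a graph \<Rightarrow> 'b graph \<Rightarrow> 'c graph \<Rightarrow> ('a \<Rightarrow> 'b) \<Rightarrow> ('a \<Rightarrow> 'c) \<Rightarrow> 'b \<Rightarrow> ('b + 'c) set" where
  "pushout_left A B C f g b = quotient_map (graph_sum B C) (gluing A f g) (Inl b)"

section \<open>Cones, disks and wedges of circles\<close>

definition cone :: "nat \<Rightarrow> 'a graph \<Rightarrow> (('a \<times> nat) + nat) set graph" where
  "cone l Y = pushout (box_product Y (path_graph 0)) (box_product Y (path_graph l)) (path_graph 0)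
     (\<lambda>(y, t). (y, t)) (\<lambda>_. 0)"

definition cone_vertex :: "nat \<Rightarrow> 'a graph \<Rightarrow> 'a \<Rightarrow> nat \<Rightarrow> (('a \<times> nat) + nat) set" where
  "cone_vertex l Y y t =
     pushout_left (box_product Y (path_graph 0)) (box_product Y (path_graph l)) (path_graph 0)
       (\<lambda>(y, t). (y, t)) (\<lambda>_. 0) (y, t)"

definition disk :: "nat \<Rightarrow> nat \<Rightarrow> ((nat \<times> nat) + nat) set graph" where
  "disk k l = cone l (cycle_graph k)"

definition disk_boundary :: "nat \<Rightarrow> nat \<Rightarrow> nat \<Rightarrow> ((nat \<times> nat) + nat) set" where
  "disk_boundary k l i = cone_vertex l (cycle_graph k) i l"

text \<open>The wedge is a pushout over \<open>I\<^sub>0\<close>, so for \<open>m = 0\<close> it is a single vertex.\<close>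

definition wedge :: "nat \<Rightarrow> ((nat \<times> nat) + nat) set graph" where
  "wedge m = pushout (graph_coprod {1..m} (\<lambda>_. path_graph 0)) (graph_coprod {1..m} (\<lambda>_. cycle_graph 5))
     (path_graph 0) (\<lambda>(i, t). (i, t)) (\<lambda>_. 0)"

definition wedge_vertex :: "nat \<Rightarrow> nat \<Rightarrow> nat \<Rightarrow> ((nat \<times> nat) + nat) set" where
  "wedge_vertex m i t =
     pushout_left (graph_coprod {1..m} (\<lambda>_. path_graph 0)) (graph_coprod {1..m} (\<lambda>_. cycle_graph 5))
       (path_graph 0) (\<lambda>(i, t). (i, t)) (\<lambda>_. 0) (i, t)"

section \<open>Words and presented groups\<close>

text \<open>The word with syllables \<open>s\<^sub>i\<close> to the power \<open>d\<close> is the list of pairs \<open>(i, d)\<close>.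
  It need not be reduced.  A word all of whose exponents are \<open>1\<close> or \<open>-1\<close> is a word in letters.\<close>

type_synonym gen_word = "(nat \<times> int) list"

definition word_over :: "nat \<Rightarrow> gen_word \<Rightarrow> bool" where
  "word_over m w \<longleftrightarrow> fst ` set w \<subseteq> {1..m}"

definition word_degree :: "gen_word \<Rightarrow> nat" where
  "word_degree w = (\<Sum>(i, d)\<leftarrow>w. nat \<bar>d\<bar>)"

definition letters :: "gen_word \<Rightarrow> gen_word" where
  "letters w = concat (map (\<lambda>(i, d). replicate (nat \<bar>d\<bar>) (i, sgn d)) w)"

lemma length_letters: "length (letters w) = word_degree w"
  by (induction w) (auto simp: letters_def word_degree_def)

definition letter_words :: "nat \<Rightarrow> gen_word set" where
  "letter_words m = lists ({1..m} \<times> {1, -1})"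

definition free_equiv :: "nat \<Rightarrow> (gen_word \<times> gen_word) set" where
  "free_equiv m = generated_equiv (letter_words m)
     {(u @ [(i, e), (i, - e)] @ v, u @ v) | u v i e.
        u \<in> letter_words m \<and> v \<in> letter_words m \<and> i \<in> {1..m} \<and> e \<in> {1, -1}}"

definition free_group :: "nat \<Rightarrow> gen_word set monoid" where
  "free_group m = \<lparr>carrier = letter_words m // free_equiv m,
     mult = (\<lambda>a b. \<Union>u\<in>a. \<Union>v\<in>b. free_equiv m `` {u @ v}),
     one = free_equiv m `` {[]}\<rparr>"

definition normal_closure :: "('a, 'b) monoid_scheme \<Rightarrow> 'a set \<Rightarrow> 'a set" where
  "normal_closure G R = \<Inter>{N. N \<lhd> G \<and> R \<subseteq> N}"

definition presented_group :: "nat \<Rightarrow> nat \<Rightarrow> (nat \<Rightarrow> gen_word) \<Rightarrow> gen_word set set monoid" where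
  "presented_group m n r =
     free_group m Mod normal_closure (free_group m) ((\<lambda>j. free_equiv m `` {letters (r j)}) ` {1..n})"

section \<open>The graph of a presentation\<close>

text \<open>The vertex \<open>v = 5 * (l - 1) + t\<close> of the cycle, with \<open>t < 5\<close>, is sent to the vertex
  \<open>\<epsilon>\<^sub>l * t mod 5\<close> of the copy indexed by the \<open>l\<close>-th letter (lists are indexed from \<open>0\<close>).\<close>

definition wrap :: "nat \<Rightarrow> gen_word \<Rightarrow> nat \<Rightarrow> ((nat \<times> nat) + nat) set" where
  "wrap m w v = (case letters w ! (v div 5) of
     (a, e) \<Rightarrow> wedge_vertex m a (nat ((e * int (v mod 5)) mod 5)))"

definition presentation_graph :: "nat \<Rightarrow> nat \<Rightarrow> (nat \<Rightarrow> gen_word) \<Rightarrow>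
    ((nat \<times> ((nat \<times> nat) + nat) set) + ((nat \<times> nat) + nat) set) set graph" where
  "presentation_graph m n r = pushout
     (graph_coprod {1..n} (\<lambda>j. cycle_graph (5 * word_degree (r j))))
     (graph_coprod {1..n} (\<lambda>j. disk (5 * word_degree (r j)) 3))
     (wedge m)
     (\<lambda>(j, v). (j, disk_boundary (5 * word_degree (r j)) 3 v))
     (\<lambda>(j, v). wrap m (r j) v)"

section \<open>The fundamental group\<close>

text \<open>A path \<open>I\<^sub>n \<rightarrow> X\<close> is the list of its \<open>n + 1\<close> values.\<close>

definition path_space :: "'a graph \<Rightarrow> nat \<Rightarrow> 'a \<Rightarrow> 'a \<Rightarrow> 'a list graph" where
  "path_space X n x y =
     (let P = {p. length p = n + 1 \<and> graph_map (path_graph n) X (\<lambda>i. p ! i) \<and> p ! 0 = x \<and> p ! n = y}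
      in \<lparr>verts = P,
          adj = {(p, q). p \<in> P \<and> q \<in> P \<and> p \<noteq> q \<and>
                   (\<forall>i\<le>n. p ! i = q ! i \<or> (p ! i, q ! i) \<in> adj X)}\<rparr>)"

text \<open>Paths of different lengths are different lists, so the union is a coproduct.\<close>

definition finite_loops :: "'a graph \<Rightarrow> 'a \<Rightarrow> 'a list graph" where
  "finite_loops X x = \<lparr>verts = (\<Union>n. verts (path_space X n x x)),
     adj = (\<Union>n. adj (path_space X n x x))\<rparr>"

definition reparam :: "'a graph \<Rightarrow> 'a \<Rightarrow> ('a list \<times> 'a list) set" where
  "reparam X x = {(p, map (\<lambda>i. p ! s i) [0..<k + 1]) | p s k n.
     p \<in> verts (path_space X n x x) \<and> mono_on {0..k} s \<and> s ` {0..k} = {0..n}}"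

definition loop_graph :: "'a graph \<Rightarrow> 'a \<Rightarrow> 'a list set graph" where
  "loop_graph X x = quotient_graph (finite_loops X x) (reparam X x)"

definition path_connected_rel :: "'a graph \<Rightarrow> ('a \<times> 'a) set" where
  "path_connected_rel G = {(u, v). \<exists>n f. graph_map (path_graph n) G f \<and> f 0 = u \<and> f n = v}"

definition path_components :: "'a graph \<Rightarrow> 'a set set" where
  "path_components G = verts G // path_connected_rel G"

definition homotopy_class :: "'a graph \<Rightarrow> 'a \<Rightarrow> 'a list \<Rightarrow> 'a list set set" where
  "homotopy_class X x p =
     path_connected_rel (loop_graph X x) `` {quotient_map (finite_loops X x) (reparam X x) p}"

text \<open>The concatenation of \<open>p\<close> and \<open>q\<close> is \<open>p @ tl q\<close>: the end point of \<open>p\<close> is the starting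
  point of \<open>q\<close> and occurs once.\<close>

definition A1 :: "'a graph \<Rightarrow> 'a \<Rightarrow> 'a list set set monoid" where
  "A1 X x = \<lparr>carrier = path_components (loop_graph X x),
     mult = (\<lambda>a b. \<Union>p\<in>\<Union>a. \<Union>q\<in>\<Union>b. homotopy_class X x (p @ tl q)),
     one = homotopy_class X x [x]\<rparr>"

section \<open>Well-formedness\<close>

lemma equiv_generated_equiv: "equiv V (generated_equiv V R)"
proof (rule equivI)
  show "sym (generated_equiv V R)"
    by (auto simp: generated_equiv_def sym_def intro: equivclp_sym)
  show "trans (generated_equiv V R)"
    by (auto simp: generated_equiv_def trans_def intro: equivclp_trans)
qed (auto simp: generated_equiv_def refl_on_def)

lemma quotient_map_in: "u \<in> verts G \<Longrightarrow> quotient_map G R u \<in> verts (quotient_graph G R)"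
  by (simp add: quotient_map_def quotient_graph_def quotientI)

lemma simple_graph_quotient: "simple_graph G \<Longrightarrow> simple_graph (quotient_graph G R)"
  by (fastforce simp: simple_graph_def quotient_graph_def quotient_map_def sym_def irrefl_def
      intro: quotientI)

lemma simple_graph_sum: "simple_graph A \<Longrightarrow> simple_graph B \<Longrightarrow> simple_graph (graph_sum A B)"
  by (auto simp: simple_graph_def graph_sum_def sym_def irrefl_def)

lemma simple_graph_coprod:
  "(\<And>i. i \<in> I \<Longrightarrow> simple_graph (G i)) \<Longrightarrow> simple_graph (graph_coprod I G)"
  by (fastforce simp: simple_graph_def graph_coprod_def sym_def irrefl_def)

lemma simple_graph_pushout:
  "simple_graph B \<Longrightarrow> simple_graph C \<Longrightarrow> simple_graph (pushout A B C f g)"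
  by (simp add: pushout_def simple_graph_quotient simple_graph_sum)

lemma simple_graph_path: "simple_graph (path_graph n)"
  by (auto simp: simple_graph_def path_graph_def sym_def irrefl_def)

lemma simple_graph_cycle:
  assumes "k \<ge> 3" shows "simple_graph (cycle_graph k)"
proof -
  have "i \<noteq> Suc i mod k" if "i < k" for i
    using that assms by (cases "Suc i = k") auto
  then show ?thesis
    by (auto simp: simple_graph_def cycle_graph_def sym_def irrefl_def)
qed

lemma simple_graph_box: "simple_graph A \<Longrightarrow> simple_graph B \<Longrightarrow> simple_graph (box_product A B)"
  by (auto simp: simple_graph_def box_product_def sym_def irrefl_def)

lemma simple_graph_wedge: "simple_graph (wedge m)"
  by (simp add: wedge_def simple_graph_pushout simple_graph_coprod simple_graph_cycle
      simple_graph_path)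

lemma simple_graph_presentation_graph:
  assumes "\<And>j. j \<in> {1..n} \<Longrightarrow> word_degree (r j) \<ge> 1"
  shows "simple_graph (presentation_graph m n r)"
  unfolding presentation_graph_def
proof (intro simple_graph_pushout simple_graph_coprod simple_graph_wedge)
  fix j assume "j \<in> {1..n}"
  with assms[of j] show "simple_graph (disk (5 * word_degree (r j)) 3)"
    by (simp add: disk_def cone_def simple_graph_pushout simple_graph_box simple_graph_path
        simple_graph_cycle)
qed

end

theory Submission
  imports Defs
begin

text \<open>
  Holonomy of a flat cocycle (a labelling of the edges by group elements that is trivial around every
  triangle and square) is invariant under homotopy of paths.  On the graph of a presentation such a
  cocycle is obtained by giving the label \<open>s\<^sub>i\<close> to the edge closing the \<open>i\<close>-th circle, the
  trivial label to all edges inside a disk, and to the edge from the \<open>v\<close>-th vertex of the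
  outer ring of the \<open>j\<close>-th disk to the wedge the prefix of the relator \<open>r\<^sub>j\<close> that has been read
  along the attaching map up to \<open>v\<close>; the last choice is consistent around the ring exactly
  because the relator is trivial in the presented group.

  Conversely, choose for every vertex a path from the base point, passing through the apex for the
  vertices of a disk.  Moving an edge across these paths changes it, up to homotopy, into
  the loop in the wedge spelled by its label, so a path is determined up to homotopy by its end
  points and the word of its labels.  The loops spelled by the relators contract across the disks.
  Hence holonomy is a complete homotopy invariant with values in the presented group, at every
  base point.
\<close>

section \<open>Paths, homotopy and holonomy\<close>

text \<open>Since \<open>close\<close> means equal or adjacent, edges and triangles are degenerate
  squares, and one square law serves both homotopies and cocycles. Flatness is where the two
  constants of the construction enter. A circle of length \<open>5\<close> contains no triangle and
  no genuine square, so one of its edges can carry a nontrivial label. In a disk of radius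
  \<open>3\<close> the apex is not adjacent to the ring \<open>s = 2\<close> next to the wedge. With
  radius \<open>2\<close> the apex would be a neighbour of every vertex of the ring next to the
  wedge, and two of these glued to the same wedge vertex would span a square although their prefixes
  may differ in the group. The other obstacle is the nesting of quotients: a vertex of the
  presentation graph is a class built from classes, and a homotopy class is a component of a
  quotient of loops. Hence the graph is compared with an isomorphic one on a datatype, in which
  squares can be examined by cases, and homotopies become rewritings of lists.\<close>

lemma quotient_map_eq_iff:
  assumes "u \<in> verts G" "v \<in> verts G"
  shows "quotient_map G R u = quotient_map G R v \<longleftrightarrow> equivclp (\<lambda>a b. (a, b) \<in> R) u v"
  using eq_equiv_class_iff[OF equiv_generated_equiv assms, of R] assms
  by (simp add: quotient_map_def generated_equiv_def)

lemma in_quotient_map_iff: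
  assumes "u \<in> verts G"
  shows "v \<in> quotient_map G R u \<longleftrightarrow> v \<in> verts G \<and> quotient_map G R u = quotient_map G R v"
  using assms quotient_map_eq_iff[OF assms, of v R]
  by (auto simp: quotient_map_def generated_equiv_def)

lemma quotient_graph_vertE:
  assumes "c \<in> verts (quotient_graph G R)"
  obtains u where "u \<in> verts G" "c = quotient_map G R u"
  using assms by (auto simp: quotient_graph_def quotient_map_def elim: quotientE)

lemma equivclp_invariant:
  assumes "equivclp Q u v" "\<And>a b. Q a b \<Longrightarrow> f a = f b"
  shows "f u = f v"
  using assms(1) by (induction rule: equivclp_induct) (use assms(2) in force)+

lemma equivclp_map:
  assumes "equivclp Q u v" "\<And>a b. Q a b \<Longrightarrow> equivclp S (f a) (f b)"
  shows "equivclp S (f u) (f v)"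
  using assms(1)
proof (induction rule: equivclp_induct)
  case base
  then show ?case by simp
next
  case (step y z)
  then show ?case using assms(2) by (meson equivclp_sym equivclp_trans)
qed

section \<open>Walks and loops as lists\<close>

definition close :: "'a graph \<Rightarrow> 'a \<Rightarrow> 'a \<Rightarrow> bool" where
  "close X a b \<longleftrightarrow> a = b \<or> (a, b) \<in> adj X"

lemma close_refl [simp]: "close X a a"
  by (simp add: close_def)

lemma close_sym: "simple_graph X \<Longrightarrow> close X a b \<Longrightarrow> close X b a"
  by (auto simp: close_def simple_graph_def sym_def)

definition walk :: "'a graph \<Rightarrow> 'a list \<Rightarrow> bool" where
  "walk X p \<longleftrightarrow> p \<noteq> [] \<and> set p \<subseteq> verts X \<and> successively (close X) p"

definition loops :: "'a graph \<Rightarrow> 'a \<Rightarrow> 'a list set" where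
  "loops X x = {p. walk X p \<and> hd p = x \<and> last p = x}"

lemma walk_concat:
  assumes "walk X p" "walk X q" "last p = hd q"
  shows "walk X (p @ tl q)" "hd (p @ tl q) = hd p" "last (p @ tl q) = last q"
  using assms by (cases q; auto simp: walk_def successively_append_iff successively_Cons)+

lemma successively_conv_nth:
  "successively P p \<longleftrightarrow> (\<forall>i. Suc i < length p \<longrightarrow> P (p ! i) (p ! Suc i))"
proof (induction P p rule: successively.induct)
  case (3 P a b p)
  then show ?case by (auto simp: nth_Cons split: nat.splits)
qed auto

text \<open>A graph map on a path graph is tested on both orientations of every edge,
  \<open>successively\<close> on the forward one only; symmetry of the adjacency bridges the
  two.\<close>

lemma verts_path_space:
  assumes "simple_graph X"
  shows "p \<in> verts (path_space X n x y) \<longleftrightarrow>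
    length p = n + 1 \<and> walk X p \<and> hd p = x \<and> last p = y"
proof (cases "length p = n + 1")
  case True
  then have ne: "p \<noteq> []" and l: "p ! 0 = hd p" "p ! n = last p"
    by (auto simp: hd_conv_nth last_conv_nth simp flip: length_greater_0_conv)
  have "(\<lambda>i. p ! i) ` {0..n} = set p"
    using True by (auto simp: set_conv_nth image_def less_Suc_eq_le)
  moreover have "(\<forall>i j. i \<le> n \<and> j \<le> n \<and> (j = i + 1 \<or> i = j + 1) \<longrightarrow> close X (p ! i) (p ! j))
      \<longleftrightarrow> successively (close X) p"
    unfolding successively_conv_nth using True close_sym[OF assms] by auto
  ultimately show ?thesis
    using ne l True by (auto simp: path_space_def graph_map_def walk_def path_graph_def close_def Let_def)
qed (auto simp: path_space_def Let_def)

lemma verts_finite_loops: "simple_graph X \<Longrightarrow> verts (finite_loops X x) = loops X x"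
  by (auto simp: finite_loops_def verts_path_space loops_def walk_def)
    (metis Suc_eq_plus1 length_Suc_conv neq_Nil_conv)

lemma adj_finite_loops:
  assumes "simple_graph X"
  shows "(p, q) \<in> adj (finite_loops X x) \<longleftrightarrow>
    p \<in> loops X x \<and> q \<in> loops X x \<and> p \<noteq> q \<and> list_all2 (close X) p q"
proof -
  have *: "(p, q) \<in> adj (path_space X n x x) \<longleftrightarrow>
    p \<in> verts (path_space X n x x) \<and> q \<in> verts (path_space X n x x) \<and> p \<noteq> q \<and>
    (\<forall>i\<le>n. close X (p ! i) (q ! i))" for n
    by (auto simp: path_space_def Let_def close_def)
  show ?thesis
    unfolding finite_loops_def
    by (auto simp: * verts_path_space[OF assms] loops_def list_all2_conv_all_nth)
      (metis Suc_pred le_imp_less_Suc length_greater_0_conv walk_def)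
qed

lemma simple_graph_finite_loops: "simple_graph X \<Longrightarrow> simple_graph (finite_loops X x)"
  unfolding simple_graph_def[of "finite_loops X x"]
  by (auto simp: adj_finite_loops verts_finite_loops sym_def irrefl_def list_all2_conv_all_nth close_sym)

section \<open>Path components\<close>

lemma path_connected_rel_eq:
  assumes "simple_graph G"
  shows "path_connected_rel G = {(u, v). u \<in> verts G \<and> v \<in> verts G \<and> (u, v) \<in> (adj G)\<^sup>*}"
proof -
  have fwd: "u \<in> verts G \<and> v \<in> verts G \<and> (u, v) \<in> (adj G)\<^sup>*"
    if "graph_map (path_graph n) G f" "f 0 = u" "f n = v" for u v n f
  proof -
    have V: "f i \<in> verts G" if "i \<le> n" for i
      using \<open>graph_map _ _ _\<close> that by (auto simp: graph_map_def path_graph_def)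
    have E: "f i = f (Suc i) \<or> (f i, f (Suc i)) \<in> adj G" if "Suc i \<le> n" for i
      using \<open>graph_map _ _ _\<close> that by (simp add: graph_map_def path_graph_def)
    have "(f 0, f i) \<in> (adj G)\<^sup>*" if "i \<le> n" for i
      using that
    proof (induction i)
      case (Suc i)
      then show ?case using E[of i] by (auto intro: rtrancl.rtrancl_into_rtrancl)
    qed simp
    then show ?thesis using V that by auto
  qed
  have bwd: "\<exists>n f. graph_map (path_graph n) G f \<and> f 0 = u \<and> f n = v"
    if "(u, v) \<in> (adj G)\<^sup>*" "u \<in> verts G" for u v
    using that
  proof (induction rule: rtrancl_induct)
    case base
    then show ?case
      by (intro exI[of _ 0] exI[of _ "\<lambda>_. u"]) (auto simp: graph_map_def path_graph_def)
  next
    case (step v w)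
    then obtain n f where f: "graph_map (path_graph n) G f" "f 0 = u" "f n = v" by blast
    have "w \<in> verts G" "(w, v) \<in> adj G"
      using step assms by (auto simp: simple_graph_def sym_def)
    then have "graph_map (path_graph (Suc n)) G (f(Suc n := w))"
      using f step(2) unfolding graph_map_def path_graph_def by (auto simp: le_Suc_eq)
    moreover have "(f(Suc n := w)) 0 = u" "(f(Suc n := w)) (Suc n) = w" using f(2) by auto
    ultimately show ?case by blast
  qed
  have "(u, v) \<in> path_connected_rel G \<longleftrightarrow> u \<in> verts G \<and> v \<in> verts G \<and> (u, v) \<in> (adj G)\<^sup>*" for u v
    unfolding path_connected_rel_def using fwd[of _ _ u v] bwd[of u v] by auto
  then show ?thesis by auto
qed

lemma equiv_path_connected_rel:
  assumes "simple_graph G" shows "equiv (verts G) (path_connected_rel G)"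
proof -
  have "sym ((adj G)\<^sup>*)" using assms by (simp add: simple_graph_def sym_rtrancl)
  then show ?thesis
    unfolding path_connected_rel_eq[OF assms]
    by (intro equivI) (auto simp: refl_on_def sym_def trans_def)
qed

lemma simple_graph_loop_graph: "simple_graph X \<Longrightarrow> simple_graph (loop_graph X x)"
  by (simp add: loop_graph_def simple_graph_quotient simple_graph_finite_loops)

section \<open>Homotopy classes of loops\<close>

context
  fixes X :: "'a graph" and x :: 'a
  assumes X: "simple_graph X"
begin

abbreviation (input) "qm \<equiv> quotient_map (finite_loops X x) (reparam X x)"

lemma qm_in: "p \<in> loops X x \<Longrightarrow> qm p \<in> verts (loop_graph X x)"
  by (simp add: loop_graph_def quotient_map_in verts_finite_loops X)

lemma homotopy_class_eq_iff:
  assumes "p \<in> loops X x" "q \<in> loops X x"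
  shows "homotopy_class X x p = homotopy_class X x q \<longleftrightarrow> (qm p, qm q) \<in> (adj (loop_graph X x))\<^sup>*"
  unfolding homotopy_class_def
  using eq_equiv_class_iff[OF equiv_path_connected_rel[OF simple_graph_loop_graph[OF X]]
      qm_in[OF assms(1)] qm_in[OF assms(2)]] qm_in assms
  by (simp add: path_connected_rel_eq[OF simple_graph_loop_graph[OF X]])

lemma homotopy_class_reparam:
  assumes "p \<in> loops X x" "q \<in> loops X x" "(p, q) \<in> reparam X x"
  shows "homotopy_class X x p = homotopy_class X x q"
proof -
  have "qm p = qm q"
    using quotient_map_eq_iff[of p "finite_loops X x" q "reparam X x"] assms
    by (auto simp: verts_finite_loops X intro: r_into_equivclp)
  then show ?thesis using assms by (simp add: homotopy_class_def)
qed

lemma homotopy_class_close: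
  assumes "p \<in> loops X x" "q \<in> loops X x" "list_all2 (close X) p q"
  shows "homotopy_class X x p = homotopy_class X x q"
proof (cases "qm p = qm q")
  case True
  then show ?thesis by (simp add: homotopy_class_def)
next
  case False
  then have "(p, q) \<in> adj (finite_loops X x)" using assms by (auto simp: adj_finite_loops X)
  with False have "(qm p, qm q) \<in> adj (loop_graph X x)"
    by (auto simp: loop_graph_def quotient_graph_def)
  then show ?thesis using homotopy_class_eq_iff assms by blast
qed

lemma homotopy_class_invariant:
  assumes "p \<in> loops X x" "q \<in> loops X x" "homotopy_class X x p = homotopy_class X x q"
    and reparam: "\<And>p q. (p, q) \<in> reparam X x \<Longrightarrow> f p = f q"
    and close: "\<And>p q. p \<in> loops X x \<Longrightarrow> q \<in> loops X x \<Longrightarrow> list_all2 (close X) p q \<Longrightarrow> f p = f q"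
  shows "f p = f q"
proof -
  have cls: "f u = f v" if "u \<in> loops X x" "v \<in> qm u" for u v
  proof -
    have "v \<in> loops X x" "qm u = qm v"
      using that in_quotient_map_iff[of u "finite_loops X x" v] by (auto simp: verts_finite_loops X)
    then have "equivclp (\<lambda>a b. (a, b) \<in> reparam X x) u v"
      using quotient_map_eq_iff[of u "finite_loops X x" v] that by (auto simp: verts_finite_loops X)
    then show ?thesis by (rule equivclp_invariant) (rule reparam)
  qed
  have self: "u \<in> qm u" if "u \<in> loops X x" for u
    using that in_quotient_map_iff[of u "finite_loops X x" u] by (auto simp: verts_finite_loops X)
  have "(qm p, qm q) \<in> (adj (loop_graph X x))\<^sup>*" using assms homotopy_class_eq_iff by blast
  \<comment> \<open>The induction speaks of all representatives of a vertex, because an edge of the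
    quotient is witnessed by some pair of representatives and not by a given one.\<close>
  then have "\<forall>u\<in>qm q. f u = f p"
  proof (induction rule: rtrancl_induct)
    case base
    then show ?case using cls[OF assms(1)] by auto
  next
    case (step c d)
    then obtain u v where uv: "c = qm u" "d = qm v" "(u, v) \<in> adj (finite_loops X x)"
      by (auto simp: loop_graph_def quotient_graph_def)
    then have "f u = f v" "u \<in> loops X x" "v \<in> loops X x"
      using close by (auto simp: adj_finite_loops X)
    then show ?case using step.IH uv self[of u] cls[of v] by auto
  qed
  then show ?thesis using self[OF assms(2)] by auto
qed

lemma carrier_A1: "carrier (A1 X x) = homotopy_class X x ` loops X x"
proof -
  have "path_components (loop_graph X x) = homotopy_class X x ` loops X x"
    unfolding path_components_def homotopy_class_def
    by (auto simp: quotient_def loop_graph_def verts_finite_loops X elim!: quotient_graph_vertE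
        intro!: bexI quotient_map_in)
  then show ?thesis by (simp add: A1_def)
qed

text \<open>A class has two layers, being a component made of reparametrization classes. The union
  flattens it to loops, and the product of \<open>A1\<close> ranges over such unions.\<close>

lemma Union_homotopy_class:
  assumes "p \<in> loops X x"
  shows "\<Union>(homotopy_class X x p) = {q \<in> loops X x. homotopy_class X x q = homotopy_class X x p}"
proof (intro Set.set_eqI iffI)
  fix q assume "q \<in> \<Union>(homotopy_class X x p)"
  then obtain c where c: "q \<in> c" "(qm p, c) \<in> path_connected_rel (loop_graph X x)"
    by (auto simp: homotopy_class_def)
  then have "c \<in> verts (loop_graph X x)"
    by (simp add: path_connected_rel_eq[OF simple_graph_loop_graph[OF X]])
  then obtain u where "u \<in> verts (finite_loops X x)" "c = qm u"
    unfolding loop_graph_def by (rule quotient_graph_vertE)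
  with c have q: "q \<in> loops X x" "c = qm q"
    using in_quotient_map_iff[of u "finite_loops X x" q] by (auto simp: verts_finite_loops X)
  then show "q \<in> {q \<in> loops X x. homotopy_class X x q = homotopy_class X x p}"
    using c homotopy_class_eq_iff[OF assms q(1)]
    by (simp add: path_connected_rel_eq[OF simple_graph_loop_graph[OF X]])
next
  fix q assume q: "q \<in> {q \<in> loops X x. homotopy_class X x q = homotopy_class X x p}"
  then have "(qm p, qm q) \<in> path_connected_rel (loop_graph X x)"
    using homotopy_class_eq_iff[OF assms, of q] qm_in assms
    by (simp add: path_connected_rel_eq[OF simple_graph_loop_graph[OF X]])
  moreover have "q \<in> qm q"
    using q in_quotient_map_iff[of q "finite_loops X x" q] by (auto simp: verts_finite_loops X)
  ultimately show "q \<in> \<Union>(homotopy_class X x p)" by (auto simp: homotopy_class_def)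
qed

lemma loops_concat: "p \<in> loops X x \<Longrightarrow> q \<in> loops X x \<Longrightarrow> p @ tl q \<in> loops X x"
  using walk_concat[of X p q] by (auto simp: loops_def)

text \<open>A multiplicative complete homotopy invariant determines the fundamental group; in particular
  its existence already shows that the product of homotopy classes is well defined.\<close>

lemma A1_iso:
  fixes H :: "('g, 'h) monoid_scheme"
  assumes H: "group H" and x: "x \<in> verts X"
    and im: "f ` loops X x = carrier H"
    and mult: "\<And>p q. p \<in> loops X x \<Longrightarrow> q \<in> loops X x \<Longrightarrow> f (p @ tl q) = f p \<otimes>\<^bsub>H\<^esub> f q"
    and inj: "\<And>p q. p \<in> loops X x \<Longrightarrow> q \<in> loops X x \<Longrightarrow>
        f p = f q \<longleftrightarrow> homotopy_class X x p = homotopy_class X x q"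
  shows "group (A1 X x)" "A1 X x \<cong> H"
proof -
  interpret H: group H by fact
  have triv: "[x] \<in> loops X x" using x by (simp add: loops_def walk_def)
  \<comment> \<open>\<open>[x] @ tl [x]\<close> is \<open>[x]\<close>, so \<open>f [x]\<close> is
    idempotent.\<close>
  have f1: "f [x] = \<one>\<^bsub>H\<^esub>"
    using mult[OF triv triv] triv im by (metis H.l_cancel_one append_Nil2 imageI list.sel(3))
  define h where "h y = homotopy_class X x (SOME p. p \<in> loops X x \<and> f p = y)" for y
  have h: "h (f p) = homotopy_class X x p" if "p \<in> loops X x" for p
    using someI[of "\<lambda>q. q \<in> loops X x \<and> f q = f p" p] that inj unfolding h_def by blast
  have mult_A1: "homotopy_class X x p \<otimes>\<^bsub>A1 X x\<^esub> homotopy_class X x q = homotopy_class X x (p @ tl q)"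
    if p: "p \<in> loops X x" and q: "q \<in> loops X x" for p q
  proof -
    have "homotopy_class X x (p' @ tl q') = homotopy_class X x (p @ tl q)"
      if "p' \<in> \<Union>(homotopy_class X x p)" "q' \<in> \<Union>(homotopy_class X x q)" for p' q'
    proof -
      have "p' \<in> loops X x" "q' \<in> loops X x" "f p' = f p" "f q' = f q"
        using that p q inj by (auto simp: Union_homotopy_class)
      then show ?thesis
        using inj[of "p' @ tl q'" "p @ tl q"] mult p q by (simp add: loops_concat)
    qed
    moreover have "p \<in> \<Union>(homotopy_class X x p)" "q \<in> \<Union>(homotopy_class X x q)"
      using p q by (auto simp: Union_homotopy_class)
    ultimately show ?thesis unfolding A1_def monoid.simps by blast
  qed
  have iso: "h \<in> iso H (A1 X x)"
  proof (rule isoI)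
    show "h \<in> hom H (A1 X x)"
      by (rule homI) (auto simp: im[symmetric] h carrier_A1 mult_A1 mult[symmetric] loops_concat)
    show "bij_betw h (carrier H) (carrier (A1 X x))"
      unfolding bij_betw_def inj_on_def carrier_A1 im[symmetric]
      by (auto simp: h inj image_image)
  qed
  \<comment> \<open>The group axioms of \<open>A1\<close> are inherited from \<open>H\<close>, as
    those of the image of a homomorphism.\<close>
  have "group (A1 X x \<lparr>carrier := h ` carrier H, one := h \<one>\<^bsub>H\<^esub>\<rparr>)"
    using iso by (intro H.hom_imp_img_group) (simp add: iso_def)
  moreover have "h ` carrier H = carrier (A1 X x)"
    using iso by (auto simp: iso_def bij_betw_def)
  moreover have "h \<one>\<^bsub>H\<^esub> = \<one>\<^bsub>A1 X x\<^esub>"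
    using h[OF triv] f1 by (simp add: A1_def)
  ultimately show "group (A1 X x)" by simp
  show "A1 X x \<cong> H" using iso H.iso_sym unfolding is_iso_def by blast
qed

end

text \<open>Homotopy of paths relative to their end points.  The contexts are arbitrary lists, so that
  homotopies can be inserted anywhere without checking that the surrounding list is a path.\<close>

inductive htpy :: "'a graph \<Rightarrow> 'a list \<Rightarrow> 'a list \<Rightarrow> bool" for X where
  htpy_refl: "htpy X p p"
| htpy_sym: "htpy X p q \<Longrightarrow> htpy X q p"
| htpy_trans [trans]: "htpy X p q \<Longrightarrow> htpy X q w \<Longrightarrow> htpy X p w"
| htpy_stutter: "htpy X (u @ a # a # v) (u @ a # v)"
| htpy_square: "close X a b \<Longrightarrow> close X b c \<Longrightarrow> close X a d \<Longrightarrow> close X d c \<Longrightarrow>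
    b \<in> verts X \<Longrightarrow> d \<in> verts X \<Longrightarrow> htpy X (u @ a # b # c # v) (u @ a # d # c # v)"

lemma htpy_context: "htpy X p q \<Longrightarrow> htpy X (u @ p @ v) (u @ q @ v)"
proof (induction rule: htpy.induct)
  case (htpy_stutter u' a v')
  then show ?case using htpy.htpy_stutter[of X "u @ u'" a "v' @ v"] by simp
next
  case (htpy_square a b c d u' v')
  then show ?case using htpy.htpy_square[of X a b c d "u @ u'" "v' @ v"] by simp
qed (auto intro: htpy.intros)

lemma htpy_append1: "htpy X p q \<Longrightarrow> htpy X (p @ v) (q @ v)"
  using htpy_context[of X p q "[]" v] by simp

lemma htpy_append2: "htpy X p q \<Longrightarrow> htpy X (u @ p) (u @ q)"
  using htpy_context[of X p q u "[]"] by simp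

text \<open>A square with three corners equal to \<open>a\<close> turns \<open>a b a\<close> into
  \<open>a a a\<close>, and two stutters are removed.\<close>

lemma htpy_backtrack:
  assumes "close X a b" "close X b a" "b \<in> verts X" "a \<in> verts X"
  shows "htpy X (u @ a # b # a # v) (u @ a # v)"
  using htpy_square[of X a b a a u v] htpy_stutter[of X u a "a # v"] htpy_stutter[of X u a v] assms
  by (auto intro: htpy_trans)

lemma htpy_triangle:
  assumes "close X a b" "close X b c" "close X a c" "b \<in> verts X" "a \<in> verts X"
  shows "htpy X (u @ a # b # c # v) (u @ a # c # v)"
  using htpy_square[of X a b c a u v] htpy_stutter[of X u a "c # v"] assms
  by (auto intro: htpy_trans)

text \<open>The turning point of the round trip is the head of \<open>p\<close>; removing it as a
  backtrack leaves the round trip of the tail.\<close>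

lemma htpy_rev:
  assumes "simple_graph X" "walk X p"
  shows "htpy X (rev p @ tl p) [last p]"
  using assms(2)
proof (induction p)
  case Nil
  then show ?case by (simp add: walk_def)
next
  case (Cons a p)
  show ?case
  proof (cases p)
    case Nil
    then show ?thesis by (simp add: htpy_refl)
  next
    case (Cons b p')
    then have w: "walk X p" "close X a b" "a \<in> verts X" "b \<in> verts X"
      using Cons.prems by (auto simp: walk_def)
    have "htpy X (rev p' @ b # a # b # p') (rev p' @ b # p')"
      using w close_sym[OF assms(1)] by (intro htpy_backtrack) auto
    moreover have "htpy X (rev p @ tl p) [last p]" using Cons.IH w by blast
    ultimately show ?thesis using Cons by (auto intro: htpy_trans)
  qed
qed

text \<open>Left cancellation in the fundamental groupoid: prefixing the reversed path contracts
  \<open>s\<close> to its end point.\<close>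

lemma htpy_cancel:
  assumes X: "simple_graph X" and w: "walk X s" "last s = a"
    and h: "htpy X (s @ p) (s @ q)"
  shows "htpy X (a # p) (a # q)"
proof -
  have *: "htpy X (rev s @ tl s @ v) (a # v)" for v
    using htpy_append1[OF htpy_rev[OF X w(1)], of v] w(2) by simp
  obtain b s' where s: "s = b # s'" using w by (cases s) (auto simp: walk_def)
  \<comment> \<open>\<open>rev s' @ s\<close> is \<open>rev s @ tl s\<close>; the first vertex of
    \<open>s\<close> must occur only once.\<close>
  have "htpy X (rev s' @ s @ p) (rev s' @ s @ q)" by (rule htpy_append2[OF h])
  then show ?thesis using *[of p] *[of q] unfolding s by (auto intro: htpy_trans htpy_sym)
qed

lemma walk_square:
  assumes "close X a b" "close X b c" "close X a d" "close X d c" "b \<in> verts X" "d \<in> verts X"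
  shows "walk X (u @ a # b # c # v) \<longleftrightarrow> walk X (u @ a # d # c # v)"
  using assms by (auto simp: walk_def successively_append_iff)

lemma loops_stutter: "u @ a # a # v \<in> loops X x \<longleftrightarrow> u @ a # v \<in> loops X x"
  by (auto simp: loops_def walk_def successively_append_iff hd_append)

lemma loops_square:
  assumes "close X a b" "close X b c" "close X a d" "close X d c" "b \<in> verts X" "d \<in> verts X"
  shows "u @ a # b # c # v \<in> loops X x \<longleftrightarrow> u @ a # d # c # v \<in> loops X x"
  using walk_square[OF assms, of u v] by (cases u) (auto simp: loops_def)

lemma reparam_stutter:
  assumes "simple_graph X" "u @ a # v \<in> loops X x"
  shows "(u @ a # v, u @ a # a # v) \<in> reparam X x"
proof -
  let ?p = "u @ a # v" and ?k = "length u + length v + 1"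
  \<comment> \<open>This surjection takes the value \<open>length u\<close>, the position of
    \<open>a\<close>, twice.\<close>
  define s where "s i = (if i \<le> length u then i else i - 1)" for i
  have "?p \<in> verts (path_space X (length u + length v) x x)"
    using assms by (simp add: verts_path_space loops_def)
  moreover have "mono_on {0..?k} s"
    by (auto simp: s_def mono_on_def)
  moreover have "s ` {0..?k} = {0..length u + length v}"
  proof
    show "{0..length u + length v} \<subseteq> s ` {0..?k}"
    proof
      fix i assume i: "i \<in> {0..length u + length v}"
      show "i \<in> s ` {0..?k}"
        by (rule image_eqI[of _ _ "if i \<le> length u then i else i + 1"]) (use i in \<open>auto simp: s_def\<close>)
    qed
  qed (auto simp: s_def)
  moreover have "u @ a # a # v = map (\<lambda>i. ?p ! s i) [0..<?k + 1]"
  proof (rule nth_equalityI)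
    fix i assume i: "i < length (u @ a # a # v)"
    have "(u @ a # a # v) ! i = ?p ! s i"
    proof (cases "i \<le> length u")
      case True
      then show ?thesis by (cases "i = length u") (auto simp: s_def nth_append)
    next
      case False
      then obtain l where "i = length u + Suc l"
        using less_imp_Suc_add[of "length u" i] by auto
      then show ?thesis
        using nth_append_length_plus[of u "a # a # v" "Suc l"] nth_append_length_plus[of u "a # v" l]
        by (simp add: s_def)
    qed
    then show "(u @ a # a # v) ! i = map (\<lambda>i. ?p ! s i) [0..<?k + 1] ! i"
      using i by (simp add: nth_append del: upt_Suc)
  qed simp
  ultimately show ?thesis unfolding reparam_def by blast
qed

lemma homotopy_class_stutter:
  assumes "simple_graph X" "u @ a # v \<in> loops X x"
  shows "homotopy_class X x (u @ a # v) = homotopy_class X x (u @ a # a # v)"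
  using assms by (intro homotopy_class_reparam reparam_stutter) (auto simp: loops_stutter)

text \<open>\<open>htpy\<close> relates arbitrary lists, so being a loop has to be carried along for
  the transitivity step.\<close>

lemma htpy_imp_homotopy_class_eq:
  assumes X: "simple_graph X" and "htpy X p q"
  shows "(p \<in> loops X x \<longleftrightarrow> q \<in> loops X x) \<and>
    (p \<in> loops X x \<longrightarrow> homotopy_class X x p = homotopy_class X x q)"
  using assms(2)
proof (induction rule: htpy.induct)
  case (htpy_stutter u a v)
  then show ?case using homotopy_class_stutter[OF X, of u a v] by (simp add: loops_stutter)
next
  case (htpy_square a b c d u v)
  note sq = loops_square[OF htpy_square, of u v x]
  have "homotopy_class X x (u @ a # b # c # v) = homotopy_class X x (u @ a # d # c # v)"
    if p: "u @ a # b # c # v \<in> loops X x"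
  proof -
    have q: "u @ a # d # c # v \<in> loops X x" using sq p by simp
    \<comment> \<open>The corners \<open>b\<close> and \<open>d\<close> need not be close, so
      \<open>a b c\<close> and \<open>a d c\<close> are not neighbours in the loop space. Stretched
      to \<open>a a b c\<close> and \<open>a d c c\<close> they are pointwise close.\<close>
    have "homotopy_class X x (u @ a # b # c # v) = homotopy_class X x (u @ a # a # b # c # v)"
      using homotopy_class_stutter[OF X p] .
    also have "\<dots> = homotopy_class X x (u @ a # d # c # c # v)"
      using p q loops_stutter[of "u @ [a,d]" c v X x] htpy_square
      by (intro homotopy_class_close X) (auto simp: loops_stutter list_all2_same intro!: list_all2_appendI)
    also have "\<dots> = homotopy_class X x (u @ a # d # c # v)"
      using homotopy_class_stutter[OF X, of "u @ [a,d]" c v x] q by simp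
    finally show ?thesis .
  qed
  then show ?case using sq by simp
qed auto

section \<open>Holonomy of a flat cocycle\<close>

fun hol :: "('g, 'h) monoid_scheme \<Rightarrow> ('a \<Rightarrow> 'a \<Rightarrow> 'g) \<Rightarrow> 'a list \<Rightarrow> 'g" where
  "hol H f (a # b # p) = f a b \<otimes>\<^bsub>H\<^esub> hol H f (b # p)"
| "hol H f [a] = \<one>\<^bsub>H\<^esub>"
| "hol H f [] = \<one>\<^bsub>H\<^esub>"

text \<open>Corners may coincide: \<open>f_square\<close> includes triangles, and together with
  \<open>f_refl\<close> it makes \<open>f b a\<close> inverse to \<open>f a b\<close> on
  edges.\<close>

locale flat_cocycle = group H for H :: "('g, 'h) monoid_scheme" (structure) +
  fixes X :: "'a graph" and f :: "'a \<Rightarrow> 'a \<Rightarrow> 'g"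
  assumes X: "simple_graph X"
    and f_closed [simp]: "a \<in> verts X \<Longrightarrow> b \<in> verts X \<Longrightarrow> f a b \<in> carrier H"
    and f_refl [simp]: "f a a = \<one>"
    and f_square: "close X a b \<Longrightarrow> close X b c \<Longrightarrow> close X a d \<Longrightarrow> close X d c \<Longrightarrow>
        {a, b, c, d} \<subseteq> verts X \<Longrightarrow> f a b \<otimes> f b c = f a d \<otimes> f d c"
begin

lemma hol_closed [simp]: "set p \<subseteq> verts X \<Longrightarrow> hol H f p \<in> carrier H"
  by (induction p rule: induct_list012) auto

lemma hol_concat:
  "set (p @ q) \<subseteq> verts X \<Longrightarrow> p \<noteq> [] \<Longrightarrow> q \<noteq> [] \<Longrightarrow> last p = hd q \<Longrightarrow>
    hol H f (p @ tl q) = hol H f p \<otimes> hol H f q"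
proof (induction p rule: induct_list012)
  case (2 a)
  then show ?case by (cases q) auto
qed (auto simp: m_assoc)

lemma hol_take_Suc:
  assumes "set p \<subseteq> verts X" "Suc i < length p"
  shows "hol H f (take (Suc (Suc i)) p) = hol H f (take (Suc i) p) \<otimes> f (p ! i) (p ! Suc i)"
proof -
  let ?q = "take (Suc i) p"
  have q: "take (Suc (Suc i)) p = ?q @ tl [p ! i, p ! Suc i]" "last ?q = p ! i" "?q \<noteq> []"
    using assms(2) by (auto simp: take_Suc_conv_app_nth)
  have "set ?q \<subseteq> verts X"
    using assms(1) set_take_subset by fast
  moreover have V: "p ! i \<in> verts X" "p ! Suc i \<in> verts X"
    using assms by (meson Suc_lessD nth_mem subsetD)+
  ultimately have "hol H f (?q @ tl [p ! i, p ! Suc i]) = hol H f ?q \<otimes> hol H f [p ! i, p ! Suc i]"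
    using q by (intro hol_concat) auto
  then show ?thesis unfolding q(1) using V by simp
qed

text \<open>The two walks are the sides of a ladder. Reading \<open>p\<close> up to \<open>i\<close>
  and then crossing the rung agrees with reading \<open>q\<close> up to \<open>i\<close>, by one
  square per step; the end rungs are trivial.\<close>

lemma hol_close:
  assumes p: "walk X p" and q: "walk X q" and pq: "list_all2 (close X) p q"
    and ends: "hd p = hd q" "last p = last q"
  shows "hol H f p = hol H f q"
proof -
  have l: "length p = length q" using pq by (rule list_all2_lengthD)
  have V: "p ! i \<in> verts X" "q ! i \<in> verts X" if "i < length p" for i
    using p q l that by (auto simp: walk_def)
  have "hol H f (take (Suc i) p) \<otimes> f (p ! i) (q ! i) = hol H f (take (Suc i) q)"
    if "i < length p" for i
    using that
  proof (induction i)
    case 0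
    then show ?case using ends p q
      by (cases p; cases q) (auto simp: walk_def)
  next
    case (Suc i)
    have S: "set (take (Suc i) p) \<subseteq> verts X" "set p \<subseteq> verts X" "set q \<subseteq> verts X"
      using p q set_take_subset by (fastforce simp: walk_def)+
    note V' = V[OF Suc.prems] V[of i]
    have c: "close X (p ! i) (p ! Suc i)" "close X (q ! i) (q ! Suc i)"
      using p q Suc.prems l by (auto simp: walk_def successively_conv_nth)
    have c': "close X (p ! i) (q ! i)" "close X (p ! Suc i) (q ! Suc i)"
      using pq Suc.prems by (auto simp: list_all2_conv_all_nth)
    have "hol H f (take (Suc (Suc i)) p) \<otimes> f (p ! Suc i) (q ! Suc i)
        = hol H f (take (Suc i) p) \<otimes> (f (p ! i) (p ! Suc i) \<otimes> f (p ! Suc i) (q ! Suc i))"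
      using S V' Suc.prems by (simp add: hol_take_Suc m_assoc)
    also have "\<dots> = hol H f (take (Suc i) p) \<otimes> (f (p ! i) (q ! i) \<otimes> f (q ! i) (q ! Suc i))"
      using V' Suc.prems c c' by (subst f_square[of _ _ _ "q ! i"]) auto
    also have "\<dots> = hol H f (take (Suc (Suc i)) q)"
      using S V' Suc l by (simp add: hol_take_Suc m_assoc[symmetric])
    finally show ?case .
  qed
  from this[of "length p - 1"] p q l ends show ?thesis
    by (simp add: walk_def last_conv_nth)
qed

lemma hol_reparam:
  assumes "(p, q) \<in> reparam X x"
  shows "hol H f p = hol H f q"
proof -
  obtain s k n where p: "p \<in> verts (path_space X n x x)" and s: "mono_on {0..k} s" "s ` {0..k} = {0..n}"
    and q: "q = map (\<lambda>i. p ! s i) [0..<k + 1]"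
    using assms by (auto simp: reparam_def)
  have p: "set p \<subseteq> verts X" "length p = Suc n"
    using p by (auto simp: verts_path_space X walk_def)
  have mono: "s i \<le> s j" if "i \<le> j" "j \<le> k" for i j
    using s(1) that by (auto simp: mono_on_def)
  have le: "s i \<le> n" if "i \<le> k" for i using s(2) that by auto
  have ex: "\<exists>i\<le>k. s i = l" if "l \<le> n" for l
    using s(2) that by (metis atLeastAtMost_iff image_iff zero_le)
  have s0: "s 0 = 0" using ex[of 0] mono[of 0] by (metis le_zero_eq zero_le)
  have sk: "s k = n" using ex[of n] mono[of _ k] le[of k] by (metis le_antisym order_refl)
  \<comment> \<open>By monotonicity a jump over \<open>Suc (s i)\<close> would leave this value
    unattained. So each step of \<open>q\<close> either repeats a vertex, contributing
    \<open>f a a\<close>, or follows a step of \<open>p\<close>.\<close>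
  have step: "s (Suc i) = s i \<or> s (Suc i) = Suc (s i)" if "Suc i \<le> k" for i
  proof (rule ccontr)
    assume *: "\<not> (s (Suc i) = s i \<or> s (Suc i) = Suc (s i))"
    with mono[of i "Suc i"] that have lt: "Suc (s i) < s (Suc i)" by auto
    have "Suc (s i) \<le> n" using lt le[OF that] by simp
    then obtain j where "j \<le> k" "s j = Suc (s i)"
      using ex by blast
    then show False using mono[of j i] mono[of "Suc i" j] lt that by (cases "j \<le> i") auto
  qed
  have q_nth: "q ! i = p ! s i" if "i \<le> k" for i
    using that unfolding q by (simp add: nth_append less_Suc_eq_le del: upt_Suc)
  have lq: "length q = Suc k" by (simp add: q)
  have sq: "set q \<subseteq> verts X" unfolding q using p le by (auto simp: less_Suc_eq_le subset_iff)
  have "hol H f (take (Suc i) q) = hol H f (take (Suc (s i)) p)" if "i \<le> k" for i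
    using that
  proof (induction i)
    case 0
    have "p \<noteq> []" "q \<noteq> []" using p(2) lq by auto
    then show ?case by (cases p; cases q) (auto simp: s0)
  next
    case (Suc i)
    have V: "p ! s i \<in> verts X"
      using p(1) nth_mem[of "s i" p] le[of i] p(2) Suc.prems by auto
    have S: "set (take (Suc (s i)) p) \<subseteq> verts X" using p(1) set_take_subset by fast
    have "hol H f (take (Suc (Suc i)) q)
        = hol H f (take (Suc (s i)) p) \<otimes> f (p ! s i) (p ! s (Suc i))"
      using hol_take_Suc[OF sq, of i] lq Suc q_nth by auto
    also have "\<dots> = hol H f (take (Suc (s (Suc i))) p)"
      using step[OF Suc.prems]
    proof
      assume "s (Suc i) = s i"
      then show ?thesis using V S by simp
    next
      assume "s (Suc i) = Suc (s i)"
      then show ?thesis using le[OF Suc.prems] hol_take_Suc[OF p(1), of "s i"] p(2) by simp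
    qed
    finally show ?case .
  qed
  note main = this
  from main[of k] show ?thesis using lq p(2) by (simp add: sk)
qed

lemma A1_iso_hol:
  assumes x: "x \<in> verts X"
    and surj: "carrier H \<subseteq> hol H f ` loops X x"
    and inj: "\<And>p q. p \<in> loops X x \<Longrightarrow> q \<in> loops X x \<Longrightarrow> hol H f p = hol H f q \<Longrightarrow> htpy X p q"
  shows "group (A1 X x) \<and> A1 X x \<cong> H"
proof -
  have "hol H f ` loops X x = carrier H"
    using surj by (auto simp: loops_def walk_def)
  moreover have "hol H f (p @ tl q) = hol H f p \<otimes> hol H f q" if "p \<in> loops X x" "q \<in> loops X x" for p q
    using that by (intro hol_concat) (auto simp: loops_def walk_def)
  moreover have "hol H f p = hol H f q \<longleftrightarrow> homotopy_class X x p = homotopy_class X x q"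
    if "p \<in> loops X x" "q \<in> loops X x" for p q
  proof
    assume "hol H f p = hol H f q"
    then show "homotopy_class X x p = homotopy_class X x q"
      using htpy_imp_homotopy_class_eq[OF X inj] that by blast
  next
    assume "homotopy_class X x p = homotopy_class X x q"
    with that show "hol H f p = hol H f q"
      by (rule homotopy_class_invariant[OF X]) (auto simp: loops_def intro: hol_reparam hol_close)
  qed
  ultimately show ?thesis using A1_iso[OF X is_group x, where f = "hol H f"] by blast
qed

end

section \<open>Presented groups\<close>

definition winv :: "gen_word \<Rightarrow> gen_word" where
  "winv w = rev (map (\<lambda>(i, e). (i, - e)) w)"

lemma winv_simps [simp]:
  "winv [] = []" "winv ((i, e) # w) = winv w @ [(i, - e)]" "winv (u @ v) = winv v @ winv u"
  by (simp_all add: winv_def)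

lemma winv_winv [simp]: "winv (winv w) = w"
  by (induction w) auto

lemma letter_words_append [simp]: "u @ v \<in> letter_words m \<longleftrightarrow> u \<in> letter_words m \<and> v \<in> letter_words m"
  by (auto simp: letter_words_def)

lemma letter_words_Cons [simp]:
  "(i, e) # w \<in> letter_words m \<longleftrightarrow> i \<in> {1..m} \<and> (e = 1 \<or> e = -1) \<and> w \<in> letter_words m"
  by (auto simp: letter_words_def)

lemma letter_words_Nil [simp]: "[] \<in> letter_words m"
  by (simp add: letter_words_def)

lemma winv_letter_words [simp]: "w \<in> letter_words m \<Longrightarrow> winv w \<in> letter_words m"
  by (induction w) auto

lemma free_equiv_append:
  assumes "(u, v) \<in> free_equiv m" "a \<in> letter_words m" "b \<in> letter_words m"
  shows "(a @ u @ b, a @ v @ b) \<in> free_equiv m"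
proof -
  define R where "R = {(u @ [(i, e), (i, - e)] @ v, u @ v) | u v i e.
        u \<in> letter_words m \<and> v \<in> letter_words m \<and> i \<in> {1..m} \<and> e \<in> {1, -1::int}}"
  have *: "free_equiv m = generated_equiv (letter_words m) R"
    by (simp add: free_equiv_def R_def)
  have "(a @ p @ b, a @ q @ b) \<in> R" if pq: "(p, q) \<in> R" for p q
  proof -
    obtain u v i e where uv: "p = u @ [(i, e), (i, - e)] @ v" "q = u @ v"
      "u \<in> letter_words m" "v \<in> letter_words m" "i \<in> {1..m}" "e \<in> {1, -1::int}"
      using pq unfolding R_def by blast
    show ?thesis unfolding R_def mem_Collect_eq
      by (rule exI[of _ "a @ u"], rule exI[of _ "v @ b"], rule exI[of _ i], rule exI[of _ e])
        (use uv assms in auto)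
  qed
  then have "equivclp (\<lambda>p q. (p, q) \<in> R) (a @ u @ b) (a @ v @ b)"
    using assms(1) equivclp_map[of "\<lambda>p q. (p, q) \<in> R" u v "\<lambda>p q. (p, q) \<in> R" "\<lambda>p. a @ p @ b"]
    by (auto simp: * generated_equiv_def r_into_equivclp)
  then show ?thesis using assms by (simp add: * generated_equiv_def)
qed

lemma equiv_free_equiv: "equiv (letter_words m) (free_equiv m)"
  by (simp add: free_equiv_def equiv_generated_equiv)

lemma free_equiv_cancel:
  assumes "w \<in> letter_words m" shows "(w @ winv w, []) \<in> free_equiv m"
  using assms
proof (induction w rule: rev_induct)
  case Nil
  then show ?case using equiv_free_equiv[of m] by (auto simp: equiv_def refl_on_def)
next
  case (snoc x w)
  obtain i e where x: "x = (i, e)" by (cases x)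
  have "w \<in> letter_words m" "winv w \<in> letter_words m" "i \<in> {1..m}" "e \<in> {1, -1}"
    using snoc.prems by (auto simp: x)
  then have "(w @ [(i, e), (i, - e)] @ winv w, w @ winv w) \<in> {(u @ [(i, e), (i, - e)] @ v, u @ v) | u v i e.
        u \<in> letter_words m \<and> v \<in> letter_words m \<and> i \<in> {1..m} \<and> e \<in> {1, -1}}"
    by blast
  then have "(w @ [(i, e), (i, - e)] @ winv w, w @ winv w) \<in> free_equiv m"
    using snoc.prems unfolding free_equiv_def generated_equiv_def x mem_Collect_eq prod.case
    by (intro conjI r_into_equivclp) auto
  then show ?case using snoc equiv_free_equiv[of m] unfolding x
    by (auto simp: equiv_def dest: transD)
qed

definition fclass :: "nat \<Rightarrow> gen_word \<Rightarrow> gen_word set" where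
  "fclass m w = free_equiv m `` {w}"

lemma fclass_eq_iff:
  "u \<in> letter_words m \<Longrightarrow> v \<in> letter_words m \<Longrightarrow> fclass m u = fclass m v \<longleftrightarrow> (u, v) \<in> free_equiv m"
  unfolding fclass_def by (rule eq_equiv_class_iff[OF equiv_free_equiv])

lemma carrier_free_group: "carrier (free_group m) = fclass m ` letter_words m"
  by (auto simp: free_group_def quotient_def fclass_def)

lemma one_free_group: "\<one>\<^bsub>free_group m\<^esub> = fclass m []"
  by (simp add: free_group_def fclass_def)

text \<open>The product is a union over all representatives; as \<open>free_equiv\<close> is a
  congruence, the sets united are all the same class.\<close>

lemma mult_free_group:
  assumes "u \<in> letter_words m" "v \<in> letter_words m"
  shows "fclass m u \<otimes>\<^bsub>free_group m\<^esub> fclass m v = fclass m (u @ v)"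
proof -
  have "fclass m (u' @ v') = fclass m (u @ v)" if "(u, u') \<in> free_equiv m" "(v, v') \<in> free_equiv m" for u' v'
  proof -
    have *: "u' \<in> letter_words m" "v' \<in> letter_words m"
      using that by (auto simp: free_equiv_def generated_equiv_def)
    have "(u @ v, u' @ v) \<in> free_equiv m" "(u' @ v, u' @ v') \<in> free_equiv m"
      using free_equiv_append[of u u' m "[]" v] free_equiv_append[of v v' m u' "[]"] that assms * by auto
    then show ?thesis using fclass_eq_iff assms * by (metis letter_words_append)
  qed
  moreover have "u \<in> fclass m u" "v \<in> fclass m v"
    using assms equiv_free_equiv[of m] by (auto simp: fclass_def equiv_def refl_on_def)
  ultimately have "(\<Union>u'\<in>fclass m u. \<Union>v'\<in>fclass m v. fclass m (u' @ v')) = fclass m (u @ v)"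
    unfolding fclass_def[of m u] fclass_def[of m v] by blast
  then show ?thesis by (simp add: free_group_def fclass_def)
qed

lemma group_free_group: "group (free_group m)"
proof (rule groupI)
  fix x assume "x \<in> carrier (free_group m)"
  then obtain w where w: "w \<in> letter_words m" "x = fclass m w" by (auto simp: carrier_free_group)
  then have "(winv w @ winv (winv w), []) \<in> free_equiv m" by (intro free_equiv_cancel) auto
  then have "fclass m (winv w) \<otimes>\<^bsub>free_group m\<^esub> x = \<one>\<^bsub>free_group m\<^esub>"
    using w by (simp add: mult_free_group one_free_group fclass_eq_iff)
  then show "\<exists>y\<in>carrier (free_group m). y \<otimes>\<^bsub>free_group m\<^esub> x = \<one>\<^bsub>free_group m\<^esub>"
    using w by (auto simp: carrier_free_group)
qed (auto simp: carrier_free_group one_free_group mult_free_group)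

lemma inv_free_group:
  assumes "w \<in> letter_words m"
  shows "inv\<^bsub>free_group m\<^esub> (fclass m w) = fclass m (winv w)"
proof -
  interpret group "free_group m" by (rule group_free_group)
  have "fclass m (winv w) \<otimes>\<^bsub>free_group m\<^esub> fclass m w = \<one>\<^bsub>free_group m\<^esub>"
    using assms free_equiv_cancel[of "winv w" m]
    by (simp add: mult_free_group one_free_group fclass_eq_iff)
  then show ?thesis using assms by (intro inv_equality) (auto simp: carrier_free_group)
qed

text \<open>The family intersected is nonempty because \<open>carrier G\<close> belongs to
  it.\<close>

lemma (in group) normal_normal_closure:
  assumes "R \<subseteq> carrier G"
  shows "normal_closure G R \<lhd> G"
proof -
  let ?S = "{N. N \<lhd> G \<and> R \<subseteq> N}"
  have "carrier G \<in> ?S" using assms by (simp add: normal_inv_iff subgroup_self)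
  then have "subgroup (\<Inter>?S) G"
    by (intro subgroups_Inter) (auto simp: normal_inv_iff)
  then show ?thesis
    unfolding normal_closure_def normal_inv_iff[of "\<Inter>?S"] by (auto simp: normal_inv_iff)
qed

lemma letters_in_letter_words: "word_over m w \<Longrightarrow> letters w \<in> letter_words m"
  by (fastforce simp: letters_def letter_words_def word_over_def sgn_if split: if_splits)

section \<open>The presented group and equality of words in it\<close>

locale presentation =
  fixes m n :: nat and r :: "nat \<Rightarrow> gen_word"
  assumes over: "\<And>j. j \<in> {1..n} \<Longrightarrow> word_over m (r j)"
    and deg: "\<And>j. j \<in> {1..n} \<Longrightarrow> word_degree (r j) \<ge> 1"
begin

abbreviation "H \<equiv> presented_group m n r"
abbreviation "LW \<equiv> letter_words m"

definition relators :: "gen_word set set" where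
  "relators = (\<lambda>j. fclass m (letters (r j))) ` {1..n}"

definition cl :: "gen_word \<Rightarrow> gen_word set set" where
  "cl w = normal_closure (free_group m) relators #>\<^bsub>free_group m\<^esub> fclass m w"

lemma letters_LW: "j \<in> {1..n} \<Longrightarrow> letters (r j) \<in> LW"
  using over by (rule letters_in_letter_words)

lemma normal_N: "normal_closure (free_group m) relators \<lhd> free_group m"
  by (rule group.normal_normal_closure[OF group_free_group])
    (auto simp: relators_def carrier_free_group letters_LW)

lemma H_eq: "H = free_group m Mod normal_closure (free_group m) relators"
  by (simp add: presented_group_def relators_def fclass_def)

lemma group_H: "group H"
  unfolding H_eq using normal_N by (rule normal.factorgroup_is_group)

lemma carrier_H: "carrier H = cl ` LW"
  by (auto simp: H_eq FactGroup_def RCOSETS_def carrier_free_group cl_def)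

lemma cl_append: "u \<in> LW \<Longrightarrow> v \<in> LW \<Longrightarrow> cl (u @ v) = cl u \<otimes>\<^bsub>H\<^esub> cl v"
  unfolding cl_def H_eq
  by (simp add: FactGroup_def normal.rcos_sum[OF normal_N] carrier_free_group mult_free_group)

lemma cl_closed [simp]: "w \<in> LW \<Longrightarrow> cl w \<in> carrier H"
  by (simp add: carrier_H)

lemma cl_Nil [simp]: "cl [] = \<one>\<^bsub>H\<^esub>"
proof -
  interpret group H by (rule group_H)
  show ?thesis using cl_append[of "[]" "[]"] by (simp add: l_cancel_one)
qed

lemma cl_winv: 
  assumes "w \<in> LW" shows "cl w \<otimes>\<^bsub>H\<^esub> cl (winv w) = \<one>\<^bsub>H\<^esub>"
proof -
  have "fclass m (w @ winv w) = fclass m []"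
    using assms free_equiv_cancel by (simp add: fclass_eq_iff)
  then have "cl (w @ winv w) = cl []" by (simp add: cl_def)
  then show ?thesis using assms by (simp add: cl_append)
qed

lemma cl_relator: 
  assumes "j \<in> {1..n}" shows "cl (letters (r j)) = \<one>\<^bsub>H\<^esub>"
proof -
  interpret F: group "free_group m" by (rule group_free_group)
  interpret N: normal "normal_closure (free_group m) relators" "free_group m" by (rule normal_N)
  have "relators \<subseteq> normal_closure (free_group m) relators" by (auto simp: normal_closure_def)
  then have "fclass m (letters (r j)) \<in> normal_closure (free_group m) relators"
    using assms by (auto simp: relators_def)
  then show ?thesis unfolding cl_def H_eq FactGroup_def
    using F.coset_join2[OF _ N.is_subgroup] by (simp add: N.rcos_const[OF F.is_group])
qed

text \<open>The words related to the empty one form a normal subgroup of the free group.\<close>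

lemma cl_eq_imp:
  assumes refl: "\<And>u. T u u" and sym: "\<And>u v. T u v \<Longrightarrow> T v u"
    and trans: "\<And>u v w. T u v \<Longrightarrow> T v w \<Longrightarrow> T u w"
    and cong: "\<And>a u v b. T u v \<Longrightarrow> T (a @ u @ b) (a @ v @ b)"
    and cancel: "\<And>i e. i \<in> {1..m} \<Longrightarrow> e \<in> {1, -1} \<Longrightarrow> T [(i, e), (i, - e)] []"
    and rel: "\<And>j. j \<in> {1..n} \<Longrightarrow> T (letters (r j)) []"
    and uv: "u \<in> LW" "v \<in> LW" "cl u = cl v"
  shows "T u v"
proof -
  interpret F: group "free_group m" by (rule group_free_group)
  interpret N: normal "normal_closure (free_group m) relators" "free_group m" by (rule normal_N)
  \<comment> \<open>\<open>cancel\<close> placed in a context by \<open>cong\<close> gives each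
    elementary cancellation, so freely equal words are related.\<close>
  have T: "T u v" if "u \<in> LW" "v \<in> LW" "fclass m u = fclass m v" for u v
  proof -
    have "equivclp (\<lambda>a b. (a, b) \<in> {(u @ [(i, e), (i, - e)] @ v, u @ v) | u v i e.
        u \<in> letter_words m \<and> v \<in> letter_words m \<and> i \<in> {1..m} \<and> e \<in> {1, -1}}) u v"
      using that by (simp add: fclass_eq_iff free_equiv_def generated_equiv_def)
    then show ?thesis
    proof (induction rule: equivclp_induct)
      case base
      then show ?case by (rule refl)
    next
      case (step y z)
      then have "T y z" using cong[OF cancel] sym by fastforce
      then show ?case using step trans by blast
    qed
  qed
  have app: "T (u @ v) []" if "T u []" "T v []" for u v
    by (rule trans[OF _ that(2)]) (use cong[OF that(1), of "[]" v] in simp)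
  have ainv: "T (a @ winv a) []" if "a \<in> LW" for a
    using T[of "a @ winv a" "[]"] free_equiv_cancel that by (simp add: fclass_eq_iff)
  have conj: "T (a @ u @ winv a) []" if "T u []" "a \<in> LW" for u a
    by (rule trans[OF _ ainv[OF that(2)]]) (use cong[OF that(1), of a "winv a"] in simp)
  have inv: "T (winv u) []" if "T u []" "u \<in> LW" for u
    by (rule trans[OF _ ainv[of "winv u"]])
      (use cong[OF sym[OF that(1)], of "winv u" "[]"] that(2) in simp_all)
  define K where "K = fclass m ` {w \<in> LW. T w []}"
  have "K \<lhd> free_group m"
    unfolding F.normal_inv_iff
  proof (intro conjI ballI F.subgroupI)
    show "K \<noteq> {}" using refl[of "[]"] letter_words_Nil[of m] unfolding K_def by blast
    fix a b assume "a \<in> K" "b \<in> K"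
    then show "a \<otimes>\<^bsub>free_group m\<^esub> b \<in> K" by (auto simp: K_def mult_free_group app)
  next
    fix x h assume "x \<in> carrier (free_group m)" "h \<in> K"
    then show "x \<otimes>\<^bsub>free_group m\<^esub> h \<otimes>\<^bsub>free_group m\<^esub> inv\<^bsub>free_group m\<^esub> x \<in> K"
      using conj by (auto simp: K_def carrier_free_group inv_free_group mult_free_group)
  qed (auto simp: K_def carrier_free_group inv_free_group inv)
  moreover have "relators \<subseteq> K" using rel letters_LW by (auto simp: relators_def K_def)
  ultimately have NK: "normal_closure (free_group m) relators \<subseteq> K"
    by (auto simp: normal_closure_def)
  have c: "fclass m u \<in> carrier (free_group m)" "fclass m v \<in> carrier (free_group m)"
    using uv by (auto simp: carrier_free_group)
  have "fclass m u \<in> normal_closure (free_group m) relators #>\<^bsub>free_group m\<^esub> fclass m v"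
    using F.rcos_self[OF c(1) N.is_subgroup] uv(3) by (simp add: cl_def)
  then have "fclass m u \<otimes>\<^bsub>free_group m\<^esub> inv\<^bsub>free_group m\<^esub> fclass m v \<in> K"
    using N.rcos_module[OF F.is_group c(2) c(1)] NK by blast
  then have "fclass m (u @ winv v) \<in> K" using uv by (simp add: inv_free_group mult_free_group)
  then obtain w where "w \<in> LW" "T w []" "fclass m (u @ winv v) = fclass m w"
    by (auto simp: K_def)
  then have "T (u @ winv v) []" using T[of "u @ winv v" w] uv trans[of _ w] by simp
  \<comment> \<open>The word \<open>u @ winv v @ v\<close> contracts to \<open>v\<close> by its
    first two factors and to \<open>u\<close> by its last two.\<close>
  then have 1: "T (u @ winv v @ v) v" using cong[of "u @ winv v" "[]" "[]" v] by simp
  have "T (winv v @ v) []" using ainv[of "winv v"] uv by simp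
  then have "T (u @ winv v @ v) u" using cong[of "winv v @ v" "[]" u "[]"] by simp
  then show ?thesis using 1 sym trans by blast
qed

end

section \<open>A coordinate model of the presentation graph and its cocycle\<close>

text \<open>\<open>Ring j v s\<close> is the vertex \<open>(v, s)\<close> of the \<open>j\<close>-th disk for \<open>s = 1, 2\<close>; those with \<open>s = 3\<close>
  are identified with vertices of the wedge.  \<open>Circ i t\<close> is used for \<open>t = 1, \<dots>, 4\<close>.\<close>

datatype vtx = Base | Circ nat nat | Ring nat nat nat | Apex nat

definition circle_vtx :: "nat \<Rightarrow> nat \<Rightarrow> vtx" where
  "circle_vtx i t = (if t = 0 then Base else Circ i t)"

fun in_wedge :: "vtx \<Rightarrow> bool" where
  "in_wedge Base = True" | "in_wedge (Circ i t) = True" | "in_wedge _ = False"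

lemma in_wedge_circle_vtx [simp]: "in_wedge (circle_vtx i t)"
  by (simp add: circle_vtx_def)

text \<open>Each letter contributes its loop without the closing \<open>Base\<close>, so that
  concatenation of words is concatenation of lists.\<close>

definition circ_word :: "gen_word \<Rightarrow> vtx list" where
  "circ_word w = concat (map (\<lambda>(i, e). Base #
     (if e = 1 then [Circ i 1, Circ i 2, Circ i 3, Circ i 4]
      else [Circ i 4, Circ i 3, Circ i 2, Circ i 1])) w)"

lemma circ_word_append [simp]: "circ_word (u @ v) = circ_word u @ circ_word v"
  by (simp add: circ_word_def)

lemma circ_word_Nil [simp]: "circ_word [] = []"
  by (simp add: circ_word_def)

lemma hd_circ_word: "hd (circ_word w @ [Base]) = Base"
  by (cases w) (auto simp: circ_word_def split: prod.splits)

context presentation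
begin

definition len :: "nat \<Rightarrow> nat" where
  "len j = 5 * word_degree (r j)"

definition attach :: "nat \<Rightarrow> nat \<Rightarrow> vtx" where
  "attach j v = (case letters (r j) ! (v div 5) of (a, e) \<Rightarrow> circle_vtx a (nat ((e * int (v mod 5)) mod 5)))"

text \<open>The label of a circle sits on the edge between \<open>4\<close> and \<open>0\<close>, which is the last edge of a
  positive letter but the first edge of a negative one.\<close>

definition relator_prefix :: "nat \<Rightarrow> nat \<Rightarrow> gen_word" where
  "relator_prefix j v = take (if v mod 5 > 0 \<and> snd (letters (r j) ! (v div 5)) = -1
     then Suc (v div 5) else v div 5) (letters (r j))"

lemma in_wedge_attach [simp]: "in_wedge (attach j v)"
  by (simp add: attach_def split: prod.split)

lemma len_ge: "j \<in> {1..n} \<Longrightarrow> len j \<ge> 5"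
  using deg[of j] by (simp add: len_def)

lemma len_pos: "j \<in> {1..n} \<Longrightarrow> 0 < len j"
  using len_ge[of j] by simp

lemma relator_prefix_LW [simp]: "j \<in> {1..n} \<Longrightarrow> relator_prefix j v \<in> LW"
  using letters_LW[of j] unfolding relator_prefix_def by (auto simp: letter_words_def dest: in_set_takeD)

lemma relator_prefix_0: "relator_prefix j 0 = []" and relator_prefix_len: "relator_prefix j (len j) = letters (r j)"
  by (simp_all add: relator_prefix_def len_def length_letters)

lemma attach_mult5: "v mod 5 = 0 \<Longrightarrow> attach j v = Base"
  by (simp add: attach_def circle_vtx_def split: prod.split)

lemma letter_nth:
  assumes "j \<in> {1..n}" "l < word_degree (r j)"
  obtains a where "letters (r j) ! l = (a, 1)" "a \<in> {1..m}"
  | a where "letters (r j) ! l = (a, -1)" "a \<in> {1..m}"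
proof -
  have "letters (r j) ! l \<in> set (letters (r j))" using assms(2) by (simp add: length_letters)
  then have "letters (r j) ! l \<in> {1..m} \<times> {1, -1}"
    using letters_LW[OF assms(1)] by (auto simp: letter_words_def)
  then show ?thesis using that by (cases "letters (r j) ! l") auto
qed

text \<open>Both cases concern the circle edge between \<open>t\<close> and
  \<open>Suc t mod 5\<close>, run forwards for a positive letter and backwards for a negative one.
  The prefix is taken at \<open>Suc v\<close> without reduction: at the end of the ring it is the
  whole relator.\<close>

lemma attach_step:
  assumes "j \<in> {1..n}" "v < len j"
  obtains a t where "a \<in> {1..m}" "t < 5" "attach j v = circle_vtx a t" "attach j (Suc v mod len j) = circle_vtx a (Suc t mod 5)"
      "relator_prefix j (Suc v) = relator_prefix j v @ (if t = 4 then [(a, 1)] else [])"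
  | a t where "a \<in> {1..m}" "t < 5" "attach j v = circle_vtx a (Suc t mod 5)" "attach j (Suc v mod len j) = circle_vtx a t"
      "relator_prefix j (Suc v) = relator_prefix j v @ (if t = 4 then [(a, -1)] else [])"
proof -
  define l t where "l = v div 5" and "t = v mod 5"
  have v: "v = 5 * l + t" "t < 5" by (auto simp: l_def t_def)
  have l: "l < word_degree (r j)" using assms(2) v by (simp add: len_def)
  have tk: "take (Suc l) (letters (r j)) = take l (letters (r j)) @ [letters (r j) ! l]"
    using l by (simp add: take_Suc_conv_app_nth length_letters)
  have v5: "v div 5 = l" "v mod 5 = t" by (auto simp: l_def t_def)
  have S: "t < 4 \<Longrightarrow> Suc v mod len j = Suc v \<and> Suc v div 5 = l \<and> Suc v mod 5 = Suc t"
    using v l by (auto simp: len_def)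
  have S4: "t = 4 \<Longrightarrow> Suc v div 5 = Suc l \<and> Suc v mod 5 = 0"
    using v by auto
  \<comment> \<open>A letter ends at \<open>Base\<close>, also where \<open>Suc v\<close> wraps
    round to \<open>0\<close>.\<close>
  have S4': "t = 4 \<Longrightarrow> attach j (Suc v mod len j) = Base"
    by (rule attach_mult5) (use S4 in \<open>simp add: len_def mod_mult2_eq\<close>)
  have t5: "t = 0 \<or> t = 1 \<or> t = 2 \<or> t = 3 \<or> t = 4" using v(2) by auto
  show ?thesis
  proof (rule letter_nth[OF assms(1) l])
    fix a assume a: "letters (r j) ! l = (a, 1)" "a \<in> {1..m}"
    show ?thesis
    proof (rule that(1)[of a t])
      show "attach j v = circle_vtx a t" using v(2) by (simp add: attach_def v5 a)
      show "attach j (Suc v mod len j) = circle_vtx a (Suc t mod 5)"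
        using S S4' v(2) by (cases "t = 4") (auto simp: attach_def a circle_vtx_def)
      show "relator_prefix j (Suc v) = relator_prefix j v @ (if t = 4 then [(a, 1)] else [])"
        using S S4 v(2) by (cases "t = 4") (auto simp: relator_prefix_def v5 a tk)
    qed (use a v in auto)
  next
    fix a assume a: "letters (r j) ! l = (a, -1)" "a \<in> {1..m}"
    show ?thesis
    \<comment> \<open>Step \<open>t\<close> of a negative letter starts at \<open>- t\<close> modulo
      \<open>5\<close>, which is \<open>Suc (4 - t) mod 5\<close>, and ends at
      \<open>4 - t\<close>.\<close>
    proof (rule that(2)[of a "4 - t"])
      show "attach j v = circle_vtx a (Suc (4 - t) mod 5)"
        using t5 by (auto simp: attach_def v5 a numeral_2_eq_2)
      show "attach j (Suc v mod len j) = circle_vtx a (4 - t)"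
        using S S4' t5 by (auto simp: attach_def a circle_vtx_def)
      show "relator_prefix j (Suc v) = relator_prefix j v @ (if 4 - t = 4 then [(a, -1)] else [])"
        using S S4 t5 by (auto simp: relator_prefix_def v5 a tk)
    qed (use a v in auto)
  qed
qed

text \<open>Each edge is listed in one direction. The outermost ring of a disk needs no clause of
  its own, since its edges are glued onto circle edges.\<close>

fun arc :: "vtx \<Rightarrow> vtx \<Rightarrow> bool" where
  "arc Base (Circ i t) \<longleftrightarrow> i \<in> {1..m} \<and> t = 1"
| "arc (Circ i t) Base \<longleftrightarrow> i \<in> {1..m} \<and> t = 4"
| "arc (Circ i t) (Circ i' t') \<longleftrightarrow> i = i' \<and> i \<in> {1..m} \<and> t \<in> {1..3} \<and> t' = Suc t"
| "arc (Ring j v s) (Ring j' v' s') \<longleftrightarrow> j = j' \<and> j \<in> {1..n} \<and> v < len j \<and>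
     (s = s' \<and> s \<in> {1, 2} \<and> v' = Suc v mod len j \<or> v = v' \<and> s = 1 \<and> s' = 2)"
| "arc (Apex j) (Ring j' v s) \<longleftrightarrow> j = j' \<and> j \<in> {1..n} \<and> v < len j \<and> s = 1"
| "arc (Ring j v s) Base \<longleftrightarrow> j \<in> {1..n} \<and> v < len j \<and> s = 2 \<and> attach j v = Base"
| "arc (Ring j v s) (Circ i t) \<longleftrightarrow> j \<in> {1..n} \<and> v < len j \<and> s = 2 \<and> attach j v = Circ i t"
| "arc _ _ \<longleftrightarrow> False"

definition K :: "vtx graph" where
  "K = \<lparr>verts = {Base} \<union> {Circ i t | i t. i \<in> {1..m} \<and> t \<in> {1..4}} \<union>
     {Ring j v s | j v s. j \<in> {1..n} \<and> v < len j \<and> s \<in> {1, 2}} \<union> {Apex j | j. j \<in> {1..n}},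
     adj = {(a, b). arc a b \<or> arc b a}\<rparr>"

lemma verts_K [simp]:
  "Base \<in> verts K"
  "Circ i t \<in> verts K \<longleftrightarrow> i \<in> {1..m} \<and> t \<in> {1..4}"
  "Ring j v s \<in> verts K \<longleftrightarrow> j \<in> {1..n} \<and> v < len j \<and> s \<in> {1, 2}"
  "Apex j \<in> verts K \<longleftrightarrow> j \<in> {1..n}"
  by (auto simp: K_def)

lemma adj_K: "(a, b) \<in> adj K \<longleftrightarrow> arc a b \<or> arc b a"
  by (simp add: K_def)

lemma close_K: "close K a b \<longleftrightarrow> a = b \<or> arc a b \<or> arc b a"
  by (simp add: close_def adj_K)

lemma circle_vtx_verts: "i \<in> {1..m} \<Longrightarrow> t < 5 \<Longrightarrow> circle_vtx i t \<in> verts K"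
  by (auto simp: circle_vtx_def)

lemma attach_verts:
  assumes "j \<in> {1..n}" "v < len j" shows "attach j v \<in> verts K"
  by (rule attach_step[OF assms]) (auto simp: circle_vtx_verts)

lemma arc_circle_vtx: "i \<in> {1..m} \<Longrightarrow> t < 5 \<Longrightarrow> arc (circle_vtx i t) (circle_vtx i (Suc t mod 5))"
  by (cases "t = 4") (auto simp: circle_vtx_def)

lemma arc_glue: "j \<in> {1..n} \<Longrightarrow> v < len j \<Longrightarrow> arc (Ring j v 2) (attach j v)"
  using in_wedge_attach[of j v] by (cases "attach j v") auto

lemma close_attach_step: "j \<in> {1..n} \<Longrightarrow> v < len j \<Longrightarrow> close K (attach j v) (attach j (Suc v mod len j))"
  by (rule attach_step[of j v]) (auto simp: close_K arc_circle_vtx)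

lemma arc_verts: "arc a b \<Longrightarrow> a \<in> verts K \<and> b \<in> verts K"
proof (induction a b rule: arc.induct)
  case (6 j v s)
  then show ?case by simp
next
  case (7 j v s i t)
  then show ?case using attach_verts[of j v] by simp
qed (auto intro: mod_less_divisor simp: len_pos)

lemma arc_irrefl: "\<not> arc a a"
proof (cases a)
  case (Ring j v s)
  then show ?thesis using len_ge[of j] by (cases "Suc v = len j") auto
qed auto

lemma simple_K: "simple_graph K"
  using arc_verts arc_irrefl by (auto simp: simple_graph_def adj_K sym_def irrefl_def)

text \<open>Labels are words and not group elements: their classes form the cocycle, while the words
  themselves spell the loops by which edges are replaced.\<close>

fun label :: "vtx \<Rightarrow> vtx \<Rightarrow> gen_word" where
  "label (Circ i t) Base = (if t = 4 then [(i, 1)] else [])"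
| "label Base (Circ i t) = (if t = 4 then [(i, -1)] else [])"
| "label (Ring j v s) Base = relator_prefix j v"
| "label (Ring j v s) (Circ i t) = relator_prefix j v"
| "label Base (Ring j v s) = winv (relator_prefix j v)"
| "label (Circ i t) (Ring j v s) = winv (relator_prefix j v)"
| "label _ _ = []"

lemma label_swap: "label b a = winv (label a b)"
  by (cases a; cases b) auto

lemma label_refl [simp]: "label a a = []"
  by (cases a) auto

lemma label_LW [simp]: "a \<in> verts K \<Longrightarrow> b \<in> verts K \<Longrightarrow> label a b \<in> LW"
  by (cases a; cases b) auto

lemma label_glue: "in_wedge b \<Longrightarrow> label (Ring j v s) b = relator_prefix j v"
  "in_wedge b \<Longrightarrow> label b (Ring j v s) = winv (relator_prefix j v)"
  by (cases b; simp)+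

lemma label_disc: "\<not> in_wedge a \<Longrightarrow> \<not> in_wedge b \<Longrightarrow> label a b = []"
  by (cases a; cases b) auto

lemma relator_prefix_Suc:
  assumes "j \<in> {1..n}" "v < len j"
  shows "relator_prefix j (Suc v) = relator_prefix j v @ label (attach j v) (attach j (Suc v mod len j))"
proof (rule attach_step[OF assms])
  fix a t assume "t < 5" "attach j v = circle_vtx a t" "attach j (Suc v mod len j) = circle_vtx a (Suc t mod 5)"
    "relator_prefix j (Suc v) = relator_prefix j v @ (if t = 4 then [(a, 1)] else [])"
  moreover from \<open>t < 5\<close> have "label (circle_vtx a t) (circle_vtx a (Suc t mod 5)) = (if t = 4 then [(a, 1)] else [])"
    by (auto simp: circle_vtx_def)
  ultimately show ?thesis by simp
next
  fix a t assume "t < 5" "attach j v = circle_vtx a (Suc t mod 5)" "attach j (Suc v mod len j) = circle_vtx a t"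
    "relator_prefix j (Suc v) = relator_prefix j v @ (if t = 4 then [(a, -1)] else [])"
  moreover from \<open>t < 5\<close> have "label (circle_vtx a (Suc t mod 5)) (circle_vtx a t) = (if t = 4 then [(a, -1)] else [])"
    by (auto simp: circle_vtx_def)
  ultimately show ?thesis by simp
qed

section \<open>Flatness of the labelling\<close>

lemma cl_rotate: 
  assumes "u \<in> LW" "v \<in> LW" "cl (u @ v) = \<one>\<^bsub>H\<^esub>" shows "cl (v @ u) = \<one>\<^bsub>H\<^esub>"
  using assms group.inv_comm[OF group_H] by (simp add: cl_append)

lemma cl_cancel [simp]: "a \<in> verts K \<Longrightarrow> b \<in> verts K \<Longrightarrow> cl (label a b @ label b a) = \<one>\<^bsub>H\<^esub>"
  using cl_winv[of "label a b"] by (simp add: cl_append label_swap[of b a])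

definition square_word :: "vtx \<Rightarrow> vtx \<Rightarrow> vtx \<Rightarrow> vtx \<Rightarrow> gen_word" where
  "square_word a b c d = label a b @ label b c @ label c d @ label d a"

lemma square_word_rotate:
  assumes "{a, b, c, d} \<subseteq> verts K" "cl (square_word b c d a) = \<one>\<^bsub>H\<^esub>"
  shows "cl (square_word a b c d) = \<one>\<^bsub>H\<^esub>"
  using cl_rotate[of "label b c @ label c d @ label d a" "label a b"] assms by (simp add: square_word_def)

definition rstep :: "nat \<Rightarrow> nat \<Rightarrow> nat \<Rightarrow> bool" where
  "rstep j v v' \<longleftrightarrow> v < len j \<and> v' < len j \<and> (v' = v \<or> v' = Suc v mod len j \<or> v = Suc v' mod len j)"

text \<open>Except at the last ring vertex the two words are equal. There one is the whole relator
  and the other is empty, and the relation of the group is used.\<close>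

lemma cl_relator_prefix_next:
  assumes "j \<in> {1..n}" "v < len j"
  shows "cl (relator_prefix j v @ label (attach j v) (attach j (Suc v mod len j))) = cl (relator_prefix j (Suc v mod len j))"
proof (cases "Suc v = len j")
  case True
  then have "cl (relator_prefix j v @ label (attach j v) (attach j (Suc v mod len j))) = cl (letters (r j))"
    using relator_prefix_Suc[OF assms] relator_prefix_len[of j] by simp
  then show ?thesis using True assms by (simp add: relator_prefix_0 cl_relator)
qed (use relator_prefix_Suc[OF assms] assms in simp)

lemma cl_relator_prefix_rstep:
  assumes j: "j \<in> {1..n}" and "rstep j v v'"
  shows "cl (relator_prefix j v @ label (attach j v) (attach j v')) = cl (relator_prefix j v')"
proof -
  interpret H: group H by (rule group_H)
  consider "v' = v" | "v' = Suc v mod len j" "v < len j" | "v = Suc v' mod len j" "v' < len j"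
    using assms(2) by (auto simp: rstep_def)
  then show ?thesis
  proof cases
    \<comment> \<open>A backward step appends the inverse of the label by which the longer prefix
      was obtained.\<close>
    case 3
    have V: "attach j v \<in> verts K" "attach j v' \<in> verts K"
      using assms attach_verts by (auto simp: rstep_def)
    have "cl (relator_prefix j v @ label (attach j v) (attach j v'))
        = cl (relator_prefix j v' @ label (attach j v') (attach j v)) \<otimes>\<^bsub>H\<^esub> cl (label (attach j v) (attach j v'))"
      using cl_relator_prefix_next[OF j 3(2)] 3(1) j V by (simp add: cl_append[of "relator_prefix j (Suc v' mod len j)"])
    also have "\<dots> = cl (relator_prefix j v') \<otimes>\<^bsub>H\<^esub> cl (label (attach j v') (attach j v) @ label (attach j v) (attach j v'))"
      using j V by (simp add: cl_append H.m_assoc del: cl_cancel)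
    finally show ?thesis using V j by simp
  qed (use cl_relator_prefix_next[OF j] in auto)
qed

lemma arc_crossing:
  assumes "close K a b" "\<not> in_wedge a" "in_wedge b"
  obtains j v where "a = Ring j v 2" "b = attach j v" "j \<in> {1..n}" "v < len j"
  using assms by (cases a; cases b) (auto simp: close_K)

lemma close_ring2:
  assumes "close K d (Ring j v 2)" "\<not> in_wedge d" "j \<in> {1..n}" "v < len j"
  obtains "d = Ring j v 1" | v' where "d = Ring j v' 2" "rstep j v v'"
  using assms len_pos[of j] by (cases d) (auto simp: close_K rstep_def)

lemma close_ring12: "close K (Ring j v 1) (Ring j' v' 2) \<Longrightarrow> j = j' \<and> v = v'"
  by (auto simp: close_K)

text \<open>The two ring vertices of such a square may be two steps apart, namely where the relator is not
  reduced; their prefixes still agree because the attaching map backtracks there.\<close>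

lemma square_crossing:
  assumes "close K a b" "close K b c" "close K c d" "close K d a" "{a, b, c, d} \<subseteq> verts K"
    and ab: "\<not> in_wedge a" "in_wedge b"
  shows "cl (square_word a b c d) = \<one>\<^bsub>H\<^esub>"
proof -
  interpret H: group H by (rule group_H)
  have V: "a \<in> verts K" "b \<in> verts K" "c \<in> verts K" "d \<in> verts K" using assms by auto
  obtain j v where a: "a = Ring j v 2" "b = attach j v" "j \<in> {1..n}" "v < len j"
    by (rule arc_crossing[OF assms(1) ab])
  have cb: "close K c b" and dc: "close K d c" and ad: "close K a d"
    using assms close_sym[OF simple_K] by blast+
  show ?thesis
  proof (cases "in_wedge d")
    case True
    then obtain j' v' where "a = Ring j' v' 2" "d = attach j' v'" by (rule arc_crossing[OF ad ab(1)])
    \<comment> \<open>A ring vertex has a single neighbour in the wedge, so the square is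
      folded.\<close>
    then have "d = b" using a by simp
    then have "cl (square_word a b c d) = cl (label a b) \<otimes>\<^bsub>H\<^esub> cl (label b c @ label c b) \<otimes>\<^bsub>H\<^esub> cl (label b a)"
      using V by (simp add: square_word_def cl_append H.m_assoc del: cl_cancel)
    also have "\<dots> = cl (label a b @ label b a)" using V by (simp add: cl_append del: cl_cancel) (simp add: cl_append[symmetric])
    finally show ?thesis using V by simp
  next
    case d: False
    show ?thesis
    proof (cases "in_wedge c")
      case True
      obtain j' v' where c: "d = Ring j' v' 2" "c = attach j' v'" "j' \<in> {1..n}" "v' < len j'"
        by (rule arc_crossing[OF dc d True])
      have "j' = j \<and> rstep j v v'"
        using close_ring2[OF assms(4)[unfolded a(1)] d a(3,4)] c(1) by (metis vtx.inject(2) num.distinct(1) one_eq_numeral_iff)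
      \<comment> \<open>Around this square one reads the prefix at \<open>v\<close>, the step of the
        attaching map, and the inverse of the prefix at \<open>v'\<close>.\<close>
      then have "cl (square_word a b c d) = cl (relator_prefix j v @ label (attach j v) (attach j v')) \<otimes>\<^bsub>H\<^esub> cl (winv (relator_prefix j v'))"
        using a c V by (simp add: square_word_def label_glue label_disc cl_append H.m_assoc)
      also have "\<dots> = \<one>\<^bsub>H\<^esub>"
        using \<open>j' = j \<and> rstep j v v'\<close> a by (simp add: cl_relator_prefix_rstep cl_winv)
      finally show ?thesis .
    next
      case c: False
      obtain j' v' where c': "c = Ring j' v' 2" "b = attach j' v'" "j' \<in> {1..n}" "v' < len j'"
        by (rule arc_crossing[OF cb c ab(2)])
      have "j' = j \<and> cl (relator_prefix j v') = cl (relator_prefix j v)"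
      proof (rule close_ring2[OF assms(4)[unfolded a(1)] d a(3,4)])
        \<comment> \<open>An inner ring vertex has only one neighbour on the ring
          \<open>s = 2\<close>, the one on its own spoke, so \<open>c\<close> coincides with
          \<open>a\<close>.\<close>
        assume "d = Ring j v 1"
        then show ?thesis using dc c' close_ring12 by blast
      next
        fix w assume w: "d = Ring j w 2" "rstep j v w"
        have w': "j' = j \<and> rstep j w v'"
          using assms(3) w len_pos[of j] c'
          by (auto simp: close_K rstep_def)
        have Vw: "attach j w \<in> verts K" using w a attach_verts by (auto simp: rstep_def)
        have "cl (relator_prefix j v') = cl (relator_prefix j v @ label (attach j v) (attach j w)) \<otimes>\<^bsub>H\<^esub> cl (label (attach j w) (attach j v'))"
          unfolding cl_relator_prefix_rstep[OF a(3) w(2)]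
          using cl_relator_prefix_rstep[of j w v'] w' a(3) Vw V(2) c'(2) by (simp add: cl_append)
        also have "attach j v' = attach j v" using a(2) c'(2) w' by simp
        also have "cl (relator_prefix j v @ label (attach j v) (attach j w)) \<otimes>\<^bsub>H\<^esub> cl (label (attach j w) (attach j v))
            = cl (relator_prefix j v) \<otimes>\<^bsub>H\<^esub> cl (label (attach j v) (attach j w) @ label (attach j w) (attach j v))"
          using a(3) Vw V(2)[unfolded a(2)] by (simp add: cl_append H.m_assoc del: cl_cancel)
        also have "\<dots> = cl (relator_prefix j v)" using Vw V(2)[unfolded a(2)] a(3) by simp
        finally show ?thesis using w' by simp
      qed
      then have "cl (square_word a b c d) = cl (relator_prefix j v) \<otimes>\<^bsub>H\<^esub> cl (winv (relator_prefix j v'))" "cl (relator_prefix j v) = cl (relator_prefix j v')"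
        using a c' c d V by (simp_all add: square_word_def label_glue label_disc cl_append)
      then show ?thesis using a by (simp add: cl_winv)
    qed
  qed
qed

lemma close_Base:
  assumes "close K Base b" "in_wedge b" "b \<noteq> Base"
  obtains i where "b = Circ i 1" | i where "b = Circ i 4"
  using assms by (cases b) (auto simp: close_K)

lemma close_Circ:
  assumes "close K (Circ i t) b" "in_wedge b" "b \<noteq> Base"
  obtains t' where "b = Circ i t'" "t' = t \<or> t' = Suc t \<or> t = Suc t'"
  using assms by (cases b) (auto simp: close_K)

text \<open>A pentagon has no genuine square, so a closed walk of four steps in the wedge is folded
  and its labels cancel in pairs.\<close>

lemma square_Base:
  assumes "close K Base b" "close K b c" "close K c d" "close K d Base"
    and "in_wedge b" "in_wedge c" "in_wedge d"
    and V: "{b, c, d} \<subseteq> verts K"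
  shows "cl (square_word Base b c d) = \<one>\<^bsub>H\<^esub>"
proof -
  have "d = b \<or> c = Base \<or> b = Base \<and> c = d \<or> d = Base \<and> b = c"
  proof (rule ccontr)
    assume neg: "\<not> ?thesis"
    have cs: "close K d c" "close K Base d" using assms close_sym[OF simple_K] by blast+
    \<comment> \<open>The neighbours of \<open>Base\<close> in the wedge sit at positions
      \<open>1\<close> and \<open>4\<close> of the circles. Away from \<open>Base\<close> the close
      vertices of the former have positions \<open>1\<close> and \<open>2\<close>, those of the
      latter \<open>3\<close> and \<open>4\<close>, and \<open>c\<close> is not
      \<open>Base\<close>.\<close>
    have end14: "x = y" if "close K Base x" "in_wedge x" "x \<noteq> Base" "close K Base y" "in_wedge y" "y \<noteq> Base"
        "close K x c" "close K y c" "x = c \<or> y = c \<or> b \<noteq> Base \<and> d \<noteq> Base" for x y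
      by (rule close_Base[OF that(1-3)]; rule close_Base[OF that(4-6)];
          use that neg assms(6) in \<open>auto elim!: close_Circ\<close>)
    show False
    proof (cases "b = Base \<or> d = Base")
      case True
      then show False using neg assms cs end14[of c d] end14[of b c] close_refl by auto
    next
      case False
      then show False using neg assms cs end14[of b d] by auto
    qed
  qed
  moreover have "cl (square_word Base b c b) = \<one>\<^bsub>H\<^esub>" "cl (square_word Base b Base d) = \<one>\<^bsub>H\<^esub>"
  proof -
    interpret H: group H by (rule group_H)
    have "cl (square_word Base b c b) = cl (label Base b) \<otimes>\<^bsub>H\<^esub> cl (label b c @ label c b) \<otimes>\<^bsub>H\<^esub> cl (label b Base)"
      using V by (simp add: square_word_def cl_append H.m_assoc del: cl_cancel)
    also have "\<dots> = cl (label Base b @ label b Base)"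
      using V by (simp add: cl_append del: cl_cancel) (simp add: cl_append[symmetric])
    finally show "cl (square_word Base b c b) = \<one>\<^bsub>H\<^esub>" using V by simp
    have "cl (square_word Base b Base d) = cl (label Base b @ label b Base) \<otimes>\<^bsub>H\<^esub> cl (label Base d @ label d Base)"
      using V by (simp add: square_word_def cl_append H.m_assoc del: cl_cancel)
    then show "cl (square_word Base b Base d) = \<one>\<^bsub>H\<^esub>" using V by simp
  qed
  moreover have "cl (square_word Base Base d d) = \<one>\<^bsub>H\<^esub>" "cl (square_word Base b b Base) = \<one>\<^bsub>H\<^esub>"
    using V by (simp_all add: square_word_def)
  ultimately show ?thesis by auto
qed

text \<open>Triviality does not depend on the starting corner, so a square entering the wedge or
  passing \<open>Base\<close> is rotated to begin there. Any other square lies inside a disk or in a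
  circle away from \<open>Base\<close>, where no edge is labelled.\<close>

lemma square_trivial:
  assumes "close K a b" "close K b c" "close K c d" "close K d a" "{a, b, c, d} \<subseteq> verts K"
  shows "cl (square_word a b c d) = \<one>\<^bsub>H\<^esub>"
proof -
  have rot: "cl (square_word a b c d) = \<one>\<^bsub>H\<^esub>"
    if "cl (square_word b c d a) = \<one>\<^bsub>H\<^esub> \<or> cl (square_word c d a b) = \<one>\<^bsub>H\<^esub> \<or> cl (square_word d a b c) = \<one>\<^bsub>H\<^esub>"
    using that assms(5) square_word_rotate[of a b c d] square_word_rotate[of b c d a]
      square_word_rotate[of c d a b] by auto
  consider "\<not> in_wedge a" "in_wedge b" | "\<not> in_wedge b" "in_wedge c" | "\<not> in_wedge c" "in_wedge d"
    | "\<not> in_wedge d" "in_wedge a" | "\<not> in_wedge a" "\<not> in_wedge b" "\<not> in_wedge c" "\<not> in_wedge d"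
    | "in_wedge a" "in_wedge b" "in_wedge c" "in_wedge d"
    by blast
  then show ?thesis
  proof cases
    case 1 then show ?thesis using square_crossing assms by blast
  next
    case 2 then show ?thesis using square_crossing[of b c d a] assms rot by auto
  next
    case 3 then show ?thesis using square_crossing[of c d a b] assms rot by auto
  next
    case 4 then show ?thesis using square_crossing[of d a b c] assms rot by auto
  next
    case 5 then show ?thesis by (simp add: square_word_def label_disc)
  next
    case 6
    consider "a = Base" | "b = Base" | "c = Base" | "d = Base"
      | "a \<noteq> Base" "b \<noteq> Base" "c \<noteq> Base" "d \<noteq> Base" by blast
    then show ?thesis
    proof cases
      case 1 then show ?thesis using square_Base[of b c d] assms 6 by auto
    next
      case 2 then show ?thesis using square_Base[of c d a] assms 6 rot by auto
    next
      case 3 then show ?thesis using square_Base[of d a b] assms 6 rot by auto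
    next
      case 4 then show ?thesis using square_Base[of a b c] assms 6 rot by auto
    next
      case 5
      then have "square_word a b c d = []"
        using 6 by (cases a; cases b; cases c; cases d) (auto simp: square_word_def)
      then show ?thesis by simp
    qed
  qed
qed

sublocale K: flat_cocycle H K "\<lambda>a b. cl (label a b)"
proof -
  interpret H: group H by (rule group_H)
  show "flat_cocycle H K (\<lambda>a b. cl (label a b))"
  proof unfold_locales
    fix a b c d assume c: "close K a b" "close K b c" "close K a d" "close K d c"
      and V: "{a, b, c, d} \<subseteq> verts K"
    have W: "label x y \<in> LW" if "x \<in> {a, b, c, d}" "y \<in> {a, b, c, d}" for x y using that V by auto
    have "cl (square_word a b c d) = \<one>\<^bsub>H\<^esub>"
      using c V close_sym[OF simple_K] by (intro square_trivial) auto
    then have "cl (label a b @ label b c) \<otimes>\<^bsub>H\<^esub> cl (label c d @ label d a) = \<one>\<^bsub>H\<^esub>"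
      using W by (simp add: square_word_def cl_append H.m_assoc)
    \<comment> \<open>The path \<open>c d a\<close> is \<open>a d c\<close> reversed, so its word is
      the inverse one, and the common right factor cancels.\<close>
    also have "\<dots> = cl (label a d @ label d c) \<otimes>\<^bsub>H\<^esub> cl (label c d @ label d a)"
      using cl_winv[of "label a d @ label d c"] W by (simp add: label_swap[of d a] label_swap[of c d])
    finally have "cl (label a b @ label b c) = cl (label a d @ label d c)"
      by (rule H.right_cancel[THEN iffD1, rotated -1]) (simp_all add: W)
    then show "cl (label a b) \<otimes>\<^bsub>H\<^esub> cl (label b c) = cl (label a d) \<otimes>\<^bsub>H\<^esub> cl (label d c)"
      using W by (simp add: cl_append)
  qed (use simple_K in auto)
qed

end

section \<open>Paths in the model\<close>

context presentation
begin

text \<open>Circles are always entered at position \<open>1\<close>, so the only circle edge not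
  followed is the one from \<open>4\<close> to \<open>0\<close>, which carries the label. Disks are
  entered along the spoke \<open>v = 0\<close>, whose foot is glued to \<open>Base\<close>. Every
  ring vertex is reached from the apex, even if this backtracks for \<open>v = 0\<close>.\<close>

fun tree :: "vtx \<Rightarrow> vtx list" where
  "tree Base = [Base]"
| "tree (Circ i t) = Base # take t [Circ i 1, Circ i 2, Circ i 3, Circ i 4]"
| "tree (Apex j) = [Base, Ring j 0 2, Ring j 0 1, Apex j]"
| "tree (Ring j v s) = [Base, Ring j 0 2, Ring j 0 1, Apex j, Ring j v 1] @ (if s = 1 then [] else [Ring j v 2])"

lemma tree_eq_Cons: "tree a = Base # tl (tree a)"
  by (cases a) auto

lemma walk_tree: "a \<in> verts K \<Longrightarrow> walk K (tree a)"
proof (cases a)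
  case (Circ i t)
  assume "a \<in> verts K"
  then have "i \<in> {1..m}" "t = 1 \<or> t = 2 \<or> t = 3 \<or> t = 4" using Circ by auto
  then show ?thesis using Circ by (auto simp: walk_def close_K take_Cons')
next
  case (Ring j v s)
  assume "a \<in> verts K"
  then show ?thesis using Ring len_pos[of j] attach_mult5[of 0 j] by (auto simp: walk_def close_K)
next
  case (Apex j)
  assume "a \<in> verts K"
  then show ?thesis using Apex len_pos[of j] attach_mult5[of 0 j] by (auto simp: walk_def close_K)
qed (auto simp: walk_def)

lemma le4E:
  fixes t :: nat assumes "1 \<le> t" "t \<le> 4" obtains "t = 1" | "t = 2" | "t = 3" | "t = 4"
  using assms by linarith

lemma last_tree: "a \<in> verts K \<Longrightarrow> last (tree a) = a"
  by (cases a) (auto simp: take_Cons' elim!: le4E)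

lemma tree_Circ_Suc: "t \<in> {1..3} \<Longrightarrow> tree (Circ i t) @ [Circ i (Suc t)] = tree (Circ i (Suc t))"
  by (cases t rule: le4E) (auto simp: take_Cons')

lemma tree_snoc: "a \<in> verts K \<Longrightarrow> tree a = butlast (tree a) @ [a]"
  using tree_eq_Cons[of a] last_tree[of a] by (metis append_butlast_last_id list.distinct(1))

section \<open>Loops spelled by words\<close>

lemma circ_word_single: 
  "circ_word [(i, e)] = Base # (if e = 1 then [Circ i 1, Circ i 2, Circ i 3, Circ i 4]
      else [Circ i 4, Circ i 3, Circ i 2, Circ i 1])"
  by (simp add: circ_word_def)

lemma walk_circ_word: "w \<in> LW \<Longrightarrow> walk K (circ_word w @ [Base])"
proof (induction w)
  case (Cons x w)
  obtain i e where x: "x = (i, e)" by (cases x)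
  have *: "walk K (circ_word w @ [Base])" using Cons by (simp add: x)
  obtain q where q: "circ_word w @ [Base] = Base # q"
    using hd_circ_word[of w] by (metis append_is_Nil_conv list.collapse list.distinct(1))
  have "circ_word (x # w) @ [Base] = circ_word [x] @ Base # q"
    using circ_word_append[of "[x]" w] q by simp
  moreover have "walk K (circ_word [x] @ Base # q)"
    using * Cons.prems unfolding q by (auto simp: x circ_word_single walk_def close_K)
  ultimately show ?case by simp
qed (simp add: walk_def)

text \<open>The loop of the opposite letter is the same circle reversed, so this is a round
  trip.\<close>

lemma htpy_circ_cancel1:
  assumes "i \<in> {1..m}" "e \<in> {1, -1}"
  shows "htpy K (circ_word [(i, e), (i, - e)] @ [Base]) [Base]"
proof -
  let ?p = "circ_word [(i, - e)] @ [Base]"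
  have "walk K ?p" using assms by (intro walk_circ_word) auto
  then have "htpy K (rev ?p @ tl ?p) [last ?p]" by (rule htpy_rev[OF simple_K])
  moreover have "rev ?p @ tl ?p = circ_word [(i, e), (i, - e)] @ [Base]"
    using assms by (auto simp: circ_word_def)
  ultimately show ?thesis by simp
qed

lemma htpy_circ_context:
  assumes "htpy K (circ_word u @ [Base]) (circ_word v @ [Base])"
  shows "htpy K (p @ circ_word u @ Base # q) (p @ circ_word v @ Base # q)"
  using htpy_context[OF assms, of p q] by simp

lemma htpy_circ_congruence:
  assumes "htpy K (circ_word u @ [Base]) (circ_word v @ [Base])"
  shows "htpy K (circ_word (a @ u @ b) @ [Base]) (circ_word (a @ v @ b) @ [Base])"
proof -
  obtain q where q: "circ_word b @ [Base] = Base # q"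
    using hd_circ_word[of b] by (metis append_is_Nil_conv list.collapse list.distinct(1))
  show ?thesis using htpy_circ_context[OF assms, of "circ_word a" q] by (simp add: q)
qed

lemma htpy_circ_winv:
  assumes "w \<in> LW" shows "htpy K (circ_word (winv w @ w) @ [Base]) [Base]"
  using assms
proof (induction w)
  case (Cons x w)
  obtain i e where x: "x = (i, e)" "i \<in> {1..m}" "e \<in> {1, -1}" using Cons.prems by (cases x) auto
  have "htpy K (circ_word [(i, - e), (i, e)] @ [Base]) (circ_word [] @ [Base])"
    using htpy_circ_cancel1[of i "- e"] x by auto
  from htpy_circ_congruence[OF this, of "winv w" w] Cons show ?case
    by (auto simp: x(1) intro: htpy_trans)
qed (simp add: htpy_refl)

text \<open>The closing \<open>Base\<close> missing from \<open>circ_word\<close> is the head of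
  \<open>tree b\<close>.\<close>

definition edge_ok :: "vtx \<Rightarrow> vtx \<Rightarrow> bool" where
  "edge_ok a b \<longleftrightarrow> htpy K (tree a @ [b]) (circ_word (label a b) @ tree b)"

lemma edge_ok_refl:
  assumes "a \<in> verts K" shows "edge_ok a a"
proof -
  have "htpy K (butlast (tree a) @ a # a # []) (butlast (tree a) @ a # [])" by (rule htpy_stutter)
  moreover have "butlast (tree a) @ [a, a] = tree a @ [a]" "butlast (tree a) @ [a] = tree a"
    using tree_snoc[OF assms] by (metis append.assoc append_Cons append_Nil)+
  ultimately show ?thesis by (simp add: edge_ok_def)
qed

text \<open>Put the loop of the inverse label in front and the vertex \<open>a\<close> behind: on
  one side the edge is backtracked, on the other the two loops cancel.\<close>

lemma edge_ok_sym:
  assumes "close K a b" "a \<in> verts K" "b \<in> verts K" "edge_ok a b"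
  shows "edge_ok b a"
proof -
  let ?u = "circ_word (label a b)" and ?v = "circ_word (label b a)"
  have 1: "htpy K (?v @ tree a @ [b, a]) (?v @ ?u @ tree b @ [a])"
    using htpy_context[OF assms(4)[unfolded edge_ok_def], of ?v "[a]"] by simp
  have 2: "htpy K (?v @ ?u @ tree b @ [a]) (tree b @ [a])"
    using htpy_append1[OF htpy_circ_winv[of "label a b"], of "tl (tree b) @ [a]"] assms(2,3)
      tree_eq_Cons[of b] by (simp add: label_swap[of b a]) (metis append_Cons)
  have "htpy K ((?v @ butlast (tree a)) @ a # b # a # []) ((?v @ butlast (tree a)) @ a # [])"
    using assms close_sym[OF simple_K] by (intro htpy_backtrack) auto
  moreover have "?v @ butlast (tree a) @ [a] = ?v @ tree a"
    "?v @ butlast (tree a) @ [a, b, a] = ?v @ tree a @ [b, a]"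
    using tree_snoc[OF assms(2)] by (metis append.assoc append_Cons append_Nil)+
  ultimately have "htpy K (?v @ tree a @ [b, a]) (?v @ tree a)" by simp
  with 1 2 show ?thesis unfolding edge_ok_def by (meson htpy_sym htpy_trans)
qed

text \<open>In the direction of \<open>arc\<close> the two lists are equal: the edge prolongs the
  tree path or closes the circle.\<close>

lemma edge_ok_wedge:
  assumes "close K a b" "a \<in> verts K" "b \<in> verts K" "in_wedge a" "in_wedge b"
  shows "edge_ok a b"
proof -
  have fwd: "edge_ok a b" if "arc a b" "in_wedge a" "in_wedge b" for a b
  proof -
    have "tree a @ [b] = circ_word (label a b) @ tree b"
      using that tree_Circ_Suc by (cases a; cases b) (auto simp: circ_word_single take_Cons')
    then show ?thesis by (simp add: edge_ok_def htpy_refl)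
  qed
  consider "a = b" | "arc a b" | "arc b a" using assms(1) by (auto simp: close_K)
  then show ?thesis
  proof cases
    case 1
    then show ?thesis using edge_ok_refl assms(2) by simp
  next
    case 3
    then show ?thesis using fwd[of b a] edge_ok_sym[of b a] assms by (simp add: close_K)
  qed (use fwd assms in auto)
qed

text \<open>On the inner ring the step is absorbed by a triangle at the apex; on the ring
  \<open>s = 2\<close> a square first pushes it to the inner ring.\<close>

lemma htpy_ring_step:
  assumes "j \<in> {1..n}" "v < len j" "s \<in> {1, 2}"
  shows "htpy K (tree (Ring j v s) @ [Ring j (Suc v mod len j) s]) (tree (Ring j (Suc v mod len j) s))"
proof -
  let ?v = "Suc v mod len j" and ?A = "[Base, Ring j 0 2, Ring j 0 1]"
  have v': "?v < len j" using len_pos[OF assms(1)] by simp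
  have tri: "htpy K (?A @ Apex j # Ring j v 1 # Ring j ?v 1 # q) (?A @ Apex j # Ring j ?v 1 # q)" for q
    by (rule htpy_triangle) (use assms v' in \<open>auto simp: close_K\<close>)
  have "htpy K ((?A @ [Apex j]) @ Ring j v 1 # Ring j v 2 # Ring j ?v 2 # [])
      ((?A @ [Apex j]) @ Ring j v 1 # Ring j ?v 1 # Ring j ?v 2 # [])"
    by (rule htpy_square) (use assms v' in \<open>auto simp: close_K\<close>)
  then show ?thesis using tri[of "[]"] tri[of "[Ring j ?v 2]"] assms(3)
    by (auto intro: htpy_trans)
qed

text \<open>The case \<open>v = len j\<close> goes once around the ring; comparing it with \<open>v = 0\<close> contracts the relator.\<close>

lemma htpy_radial:
  assumes j: "j \<in> {1..n}" and "v \<le> len j"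
  shows "htpy K (tree (Ring j (v mod len j) 2) @ [attach j (v mod len j)])
    (circ_word (relator_prefix j v) @ tree (attach j (v mod len j)))"
  using assms(2)
proof (induction v)
  case 0
  \<comment> \<open>\<open>tree (Ring j 0 2)\<close> followed by \<open>Base\<close> runs along the
    spoke to the apex and back.\<close>
  let ?p = "[Apex j, Ring j 0 1, Ring j 0 2, Base]"
  have "walk K ?p" using j len_pos[of j] attach_mult5[of 0 j] by (auto simp: walk_def close_K)
  then have "htpy K (rev ?p @ tl ?p) [last ?p]" by (rule htpy_rev[OF simple_K])
  then show ?case by (simp add: relator_prefix_0 attach_mult5)
next
  case (Suc v)
  let ?v = "Suc v mod len j"
  have v: "v < len j" "?v < len j" using Suc.prems len_pos[OF j] by auto
  let ?R = "butlast (tree (Ring j v 2))"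
  have R: "tree (Ring j v 2) = ?R @ [Ring j v 2]" by simp
  have cl: "close K (attach j v) (attach j ?v)" using close_attach_step[OF j v(1)] .
  have V: "attach j v \<in> verts K" "attach j ?v \<in> verts K" using attach_verts j v by auto
  \<comment> \<open>The spoke at the new vertex is reached from the old ring vertex; a square moves
    the step from the ring into the wedge, behind the old spoke, where the induction hypothesis
    applies.\<close>
  have "htpy K (tree (Ring j ?v 2) @ [attach j ?v]) ((tree (Ring j v 2) @ [Ring j ?v 2]) @ [attach j ?v])"
    by (rule htpy_append1[OF htpy_sym[OF htpy_ring_step[OF j v(1)]]]) simp
  also have "(tree (Ring j v 2) @ [Ring j ?v 2]) @ [attach j ?v] = ?R @ Ring j v 2 # Ring j ?v 2 # attach j ?v # []"
    by simp
  also have "htpy K \<dots> (?R @ Ring j v 2 # attach j v # attach j ?v # [])"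
    by (rule htpy_square) (use j v V cl arc_glue in \<open>auto simp: close_K\<close>)
  also have "?R @ Ring j v 2 # attach j v # attach j ?v # [] = (tree (Ring j v 2) @ [attach j v]) @ [attach j ?v]"
    by simp
  also have "htpy K \<dots> ((circ_word (relator_prefix j v) @ tree (attach j v)) @ [attach j ?v])"
    by (rule htpy_append1) (use Suc v in simp)
  also have "(circ_word (relator_prefix j v) @ tree (attach j v)) @ [attach j ?v] = circ_word (relator_prefix j v) @ (tree (attach j v) @ [attach j ?v])"
    by simp
  also have "htpy K \<dots> (circ_word (relator_prefix j v) @ (circ_word (label (attach j v) (attach j ?v)) @ tree (attach j ?v)))"
    by (rule htpy_append2, rule edge_ok_wedge[unfolded edge_ok_def]) (use cl V in simp_all)
  also have "\<dots> = circ_word (relator_prefix j (Suc v)) @ tree (attach j ?v)"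
    by (simp add: relator_prefix_Suc[OF j v(1)])
  finally show ?case .
qed

lemma htpy_relator:
  assumes "j \<in> {1..n}"
  shows "htpy K (circ_word (letters (r j)) @ [Base]) [Base]"
proof -
  have "htpy K (tree (Ring j 0 2) @ [Base]) (circ_word (letters (r j)) @ [Base])"
    using htpy_radial[OF assms, of "len j"] by (simp add: attach_mult5 relator_prefix_len)
  moreover have "htpy K (tree (Ring j 0 2) @ [Base]) [Base]"
    using htpy_radial[OF assms, of 0] by (simp add: attach_mult5 relator_prefix_0)
  ultimately show ?thesis by (meson htpy_sym htpy_trans)
qed

lemma edge_ok_arc:
  assumes "arc a b" shows "edge_ok a b"
proof (cases "in_wedge a")
  case True
  then show ?thesis using assms arc_verts[OF assms]
    by (cases a; cases b) (auto intro!: edge_ok_wedge simp: close_K)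
next
  case a: False
  show ?thesis
  proof (cases "in_wedge b")
    case True
    obtain j v where "a = Ring j v 2" "b = attach j v" "j \<in> {1..n}" "v < len j"
      by (rule arc_crossing[OF _ a True]) (use assms in \<open>simp_all add: close_K\<close>)
    then show ?thesis using htpy_radial[of j v] by (simp add: edge_ok_def label_glue)
  next
    case b: False
    show ?thesis
    proof (cases "\<exists>j v s. a = Ring j v s \<and> b = Ring j (Suc v mod len j) s")
      case True
      then obtain j v s where ab: "a = Ring j v s" "b = Ring j (Suc v mod len j) s" by blast
      then have "j \<in> {1..n}" "v < len j" "s \<in> {1, 2}" using assms by auto
      from htpy_ring_step[OF this] show ?thesis by (simp add: edge_ok_def ab)
    next
      case False
      \<comment> \<open>Only arcs from the apex and along spokes remain, and tree paths follow
        these.\<close>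
      then have "tree a @ [b] = tree b" using assms a b by (cases a; cases b) auto
      then show ?thesis using a b by (simp add: edge_ok_def label_disc htpy_refl)
    qed
  qed
qed

lemma edge_ok_close:
  assumes "close K a b" "a \<in> verts K" "b \<in> verts K"
  shows "edge_ok a b"
proof -
  consider "a = b" | "arc a b" | "arc b a" using assms(1) by (auto simp: close_K)
  then show ?thesis
  proof cases
    case 1
    then show ?thesis using edge_ok_refl assms(2) by simp
  next
    case 3
    then show ?thesis using edge_ok_arc[of b a] edge_ok_sym[of b a] assms by (simp add: close_K)
  qed (use edge_ok_arc in auto)
qed

section \<open>Completeness and surjectivity of holonomy\<close>

fun path_label :: "vtx list \<Rightarrow> gen_word" where
  "path_label (a # b # p) = label a b @ path_label (b # p)"
| "path_label _ = []"

lemma path_label_LW [simp]: "set p \<subseteq> verts K \<Longrightarrow> path_label p \<in> LW"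
  by (induction p rule: path_label.induct) auto

lemma hol_eq_cl_path_label: "set p \<subseteq> verts K \<Longrightarrow> hol H (\<lambda>a b. cl (label a b)) p = cl (path_label p)"
  by (induction p rule: path_label.induct) (auto simp: cl_append)

text \<open>Normal form of a walk: replacing its edges one by one collects their loops in front and
  leaves the tree path to its end.\<close>

lemma htpy_tree_walk:
  "walk K p \<Longrightarrow> htpy K (tree (hd p) @ tl p) (circ_word (path_label p) @ tree (last p))"
proof (induction p rule: path_label.induct)
  case (1 a b p)
  then have "walk K (b # p)" "close K a b" "a \<in> verts K" "b \<in> verts K" by (auto simp: walk_def)
  then have "htpy K ((tree a @ [b]) @ p) ((circ_word (label a b) @ tree b) @ p)"
    "htpy K (circ_word (label a b) @ (tree b @ p)) (circ_word (label a b) @ (circ_word (path_label (b # p)) @ tree (last (b # p))))"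
    using htpy_append1[OF edge_ok_close[unfolded edge_ok_def], of a b p]
      htpy_append2[OF "1.IH", of "circ_word (label a b)"] by simp_all
  then show ?case by (auto intro: htpy_trans)
qed (auto simp: walk_def htpy_refl)

lemma htpy_if_hol_eq:
  assumes "walk K p" "walk K q" "hd p = hd q" "last p = last q"
    and "hol H (\<lambda>a b. cl (label a b)) p = hol H (\<lambda>a b. cl (label a b)) q"
  shows "htpy K p q"
proof -
  have V: "set p \<subseteq> verts K" "set q \<subseteq> verts K" "hd p \<in> verts K" "p \<noteq> []" "q \<noteq> []"
    using assms by (auto simp: walk_def)
  let ?T = "\<lambda>u v. htpy K (circ_word u @ [Base]) (circ_word v @ [Base])"
  have "?T (path_label p) (path_label q)"
  \<comment> \<open>Homotopy of spelled loops is a congruence that contains the free cancellations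
    and the relators, hence equality in \<open>H\<close>.\<close>
  proof (rule cl_eq_imp[where T = ?T])
    show "?T u u" for u by (rule htpy_refl)
    show "?T v u" if "?T u v" for u v using that by (rule htpy_sym)
    show "?T u w" if "?T u v" "?T v w" for u v w using that by (rule htpy_trans)
    show "?T (a @ u @ b) (a @ v @ b)" if "?T u v" for a u v b
      using that by (rule htpy_circ_congruence)
    show "?T [(i, e), (i, - e)] []" if "i \<in> {1..m}" "e \<in> {1, - 1}" for i e
      using htpy_circ_cancel1[OF that] by simp
    show "?T (letters (r j)) []" if "j \<in> {1..n}" for j using htpy_relator[OF that] by simp
    show "cl (path_label p) = cl (path_label q)" using assms(5) V by (simp add: hol_eq_cl_path_label)
  qed (use V in auto)
  from htpy_circ_context[OF this, of "[]" "tl (tree (last p))"]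
  have "htpy K (circ_word (path_label p) @ tree (last p)) (circ_word (path_label q) @ tree (last p))"
    using tree_eq_Cons[of "last p"] by simp
  then have "htpy K (tree (hd p) @ tl p) (tree (hd p) @ tl q)"
    using htpy_tree_walk[OF assms(1)] htpy_tree_walk[OF assms(2)] assms(3,4)
    by (metis htpy_sym htpy_trans)
  \<comment> \<open>The tree path to the common starting point is cancelled, which returns from the
    base point to the given one.\<close>
  then have "htpy K (hd p # tl p) (hd q # tl q)"
    using htpy_cancel[OF simple_K walk_tree last_tree] V(3) assms(3) by metis
  then show ?thesis using V by simp
qed

lemma path_label_circ_word:
  "w \<in> LW \<Longrightarrow> path_label (circ_word w @ [Base]) = w"
proof (induction w)
  case (Cons x w)
  obtain i e where x: "x = (i, e)" by (cases x)
  obtain q where q: "circ_word w @ [Base] = Base # q"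
    using hd_circ_word[of w] by (metis append_is_Nil_conv list.collapse list.distinct(1))
  have "circ_word (x # w) @ [Base] = circ_word [x] @ Base # q"
    using circ_word_append[of "[x]" w] q by simp
  then show ?case using Cons q by (auto simp: x circ_word_single)
qed simp

lemma hol_surj:
  assumes x: "x \<in> verts K" and y: "y \<in> carrier H"
  obtains p where "p \<in> loops K x" "hol H (\<lambda>a b. cl (label a b)) p = y"
proof -
  let ?h = "hol H (\<lambda>a b. cl (label a b))"
  let ?s = "tree x" and ?b = "rev (tree x)"
  have s: "walk K ?s" "hd ?s = Base" "last ?s = x"
    using walk_tree[OF x] last_tree[OF x] arg_cong[OF tree_eq_Cons[of x], of hd] by simp_all
  have "successively (\<lambda>a b. close K b a) ?s"
    using s(1) close_sym[OF simple_K] unfolding walk_def by (blast intro: successively_mono)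
  then have b: "walk K ?b" "hd ?b = x" "last ?b = Base"
    using s by (simp_all add: walk_def hd_rev last_rev)
  have hs: "?h ?s \<in> carrier H" "?h ?b \<in> carrier H" using s b by (auto simp: walk_def)
  \<comment> \<open>The loop goes from \<open>x\<close> to \<open>Base\<close>, along a spelled
    loop, and back. The holonomies of the two legs are not computed but divided out in the choice of
    \<open>w\<close>.\<close>
  then have "inv\<^bsub>H\<^esub> (?h ?b) \<otimes>\<^bsub>H\<^esub> y \<otimes>\<^bsub>H\<^esub> inv\<^bsub>H\<^esub> (?h ?s) \<in> cl ` LW"
    unfolding carrier_H[symmetric] using y by simp
  then obtain w where w: "w \<in> LW" "cl w = inv\<^bsub>H\<^esub> (?h ?b) \<otimes>\<^bsub>H\<^esub> y \<otimes>\<^bsub>H\<^esub> inv\<^bsub>H\<^esub> (?h ?s)"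
    by force
  let ?c = "circ_word w @ [Base]"
  have c: "walk K ?c" "hd ?c = Base" "last ?c = Base"
    using walk_circ_word[OF w(1)] hd_circ_word by auto
  have hc: "?h ?c = cl w" using c path_label_circ_word[OF w(1)] hol_eq_cl_path_label[of ?c] by (simp add: walk_def)
  have bc: "walk K (?b @ tl ?c)" "hd (?b @ tl ?c) = x" "last (?b @ tl ?c) = Base"
    using walk_concat[OF b(1) c(1)] b c by auto
  have "(?b @ tl ?c) @ tl ?s \<in> loops K x"
    using walk_concat[OF bc(1) s(1)] bc s by (simp add: loops_def)
  moreover have "?h ((?b @ tl ?c) @ tl ?s) = ?h (?b @ tl ?c) \<otimes>\<^bsub>H\<^esub> ?h ?s"
    by (rule K.hol_concat) (use bc s in \<open>auto simp: walk_def\<close>)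
  moreover have "?h (?b @ tl ?c) = ?h ?b \<otimes>\<^bsub>H\<^esub> ?h ?c"
    by (rule K.hol_concat) (use b c in \<open>auto simp: walk_def\<close>)
  moreover have "?h ?b \<otimes>\<^bsub>H\<^esub> cl w \<otimes>\<^bsub>H\<^esub> ?h ?s = y"
  proof -
    have "?h ?b \<otimes>\<^bsub>H\<^esub> cl w = y \<otimes>\<^bsub>H\<^esub> inv\<^bsub>H\<^esub> (?h ?s)"
      using hs y by (simp add: w(2) K.m_assoc[symmetric])
    then show ?thesis using hs y by (simp add: K.m_assoc)
  qed
  ultimately show ?thesis using that hc by metis
qed

end

section \<open>Coordinates on the presentation graph\<close>

lemma close_quotient_graph:
  "close G u v \<Longrightarrow> close (quotient_graph G R) (quotient_map G R u) (quotient_map G R v)"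
  by (auto simp: close_def quotient_graph_def)

text \<open>The arbitrary choice of a member is harmless when \<open>f\<close> respects the
  gluing.\<close>

definition quotient_lift :: "('a \<Rightarrow> 'b) \<Rightarrow> 'a set \<Rightarrow> 'b" where
  "quotient_lift f c = f (SOME u. u \<in> c)"

lemma quotient_lift_map:
  assumes "u \<in> verts G" "\<And>a b. (a, b) \<in> R \<Longrightarrow> f a = f b"
  shows "quotient_lift f (quotient_map G R u) = f u"
proof -
  let ?v = "SOME v. v \<in> quotient_map G R u"
  have "u \<in> quotient_map G R u" using assms(1) by (simp add: in_quotient_map_iff)
  then have "?v \<in> quotient_map G R u" by (rule someI)
  then have "equivclp (\<lambda>a b. (a, b) \<in> R) u ?v"
    using in_quotient_map_iff[OF assms(1)] quotient_map_eq_iff[OF assms(1)] by blast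
  then show ?thesis unfolding quotient_lift_def using equivclp_invariant[of _ u ?v f] assms(2) by simp
qed

lemma htpy_map:
  assumes "htpy K p q" "\<And>a b. close K a b \<Longrightarrow> close X (h a) (h b)" "\<And>a. a \<in> verts K \<Longrightarrow> h a \<in> verts X"
  shows "htpy X (map h p) (map h q)"
  using assms(1)
proof (induction rule: htpy.induct)
  case (htpy_stutter u a v)
  then show ?case using htpy.htpy_stutter[of X "map h u" "h a" "map h v"] by simp
next
  case (htpy_square a b c d u v)
  then show ?case using htpy.htpy_square[of X "h a" "h b" "h c" "h d" "map h u" "map h v"] assms(2,3) by simp
qed (auto intro: htpy.intros)

lemma walk_map:
  assumes "walk K p" "\<And>a b. close K a b \<Longrightarrow> close X (h a) (h b)" "\<And>a. a \<in> verts K \<Longrightarrow> h a \<in> verts X"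
  shows "walk X (map h p)"
  using assms by (auto simp: walk_def successively_map elim: successively_mono)

lemma hol_map: "hol H (\<lambda>a b. f (F a) (F b)) p = hol H f (map F p)"
  by (induction p rule: induct_list012) auto

text \<open>The cocycle is pulled back along \<open>F\<close> and homotopies are carried over by its
  inverse \<open>h\<close>, so surjectivity and completeness of holonomy have to be known for
  \<open>X\<close> only.\<close>

lemma (in flat_cocycle) A1_iso_transport:
  assumes Y: "simple_graph Y" and y: "y \<in> verts Y"
    and F: "\<And>c. c \<in> verts Y \<Longrightarrow> F c \<in> verts X" "\<And>c d. close Y c d \<Longrightarrow> close X (F c) (F d)"
    and h: "\<And>a. a \<in> verts X \<Longrightarrow> h a \<in> verts Y" "\<And>a b. close X a b \<Longrightarrow> close Y (h a) (h b)"
    and hF: "\<And>c. c \<in> verts Y \<Longrightarrow> h (F c) = c" and Fh: "\<And>a. a \<in> verts X \<Longrightarrow> F (h a) = a"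
    and surj: "carrier H \<subseteq> hol H f ` loops X (F y)"
    and inj: "\<And>p q. p \<in> loops X (F y) \<Longrightarrow> q \<in> loops X (F y) \<Longrightarrow> hol H f p = hol H f q \<Longrightarrow> htpy X p q"
  shows "group (A1 Y y) \<and> A1 Y y \<cong> H"
proof -
  interpret Y: flat_cocycle H Y "\<lambda>a b. f (F a) (F b)"
  proof unfold_locales
    fix a b c d assume "close Y a b" "close Y b c" "close Y a d" "close Y d c" "{a, b, c, d} \<subseteq> verts Y"
    then show "f (F a) (F b) \<otimes> f (F b) (F c) = f (F a) (F d) \<otimes> f (F d) (F c)"
      using F by (intro f_square) auto
  qed (use Y F in auto)
  have hF': "map h (map F p) = p" if "walk Y p" for p
    using that hF by (auto simp: walk_def map_idI subset_iff)
  have Fh': "map F (map h p) = p" if "walk X p" for p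
    using that Fh by (auto simp: walk_def map_idI subset_iff)
  have loop: "map F p \<in> loops X (F y)" if "p \<in> loops Y y" for p
    using that walk_map[of Y p X F] F by (auto simp: loops_def walk_def hd_map last_map)
  show ?thesis
  proof (rule Y.A1_iso_hol[OF y])
    show "carrier H \<subseteq> hol H (\<lambda>a b. f (F a) (F b)) ` loops Y y"
    proof
      fix g assume "g \<in> carrier H"
      then obtain p where p: "p \<in> loops X (F y)" "g = hol H f p" using surj by auto
      then have "map h p \<in> loops Y y"
        using walk_map[of X p Y h] h hF[OF y] by (auto simp: loops_def walk_def hd_map last_map)
      moreover have "hol H (\<lambda>a b. f (F a) (F b)) (map h p) = g"
        using p Fh' unfolding hol_map by (simp add: loops_def del: map_map)
      ultimately show "g \<in> hol H (\<lambda>a b. f (F a) (F b)) ` loops Y y" by blast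
    qed
    show "htpy Y p q" if "p \<in> loops Y y" "q \<in> loops Y y"
      "hol H (\<lambda>a b. f (F a) (F b)) p = hol H (\<lambda>a b. f (F a) (F b)) q" for p q
    proof -
      have "htpy X (map F p) (map F q)"
        using that loop unfolding hol_map by (intro inj)
      then have "htpy Y (map h (map F p)) (map h (map F q))" using h by (intro htpy_map[of X _ _ Y h])
      then show ?thesis
        using that hF'[of p] hF'[of q] by (simp add: loops_def del: map_map)
    qed
  qed
qed

section \<open>Disks and the wedge as quotients\<close>

lemma close_graph_sum:
  "close A a a' \<Longrightarrow> close (graph_sum A B) (Inl a) (Inl a')"
  "close B b b' \<Longrightarrow> close (graph_sum A B) (Inr b) (Inr b')"
  by (auto simp: close_def graph_sum_def)

lemma close_graph_coprod:
  "i \<in> I \<Longrightarrow> close (G i) a a' \<Longrightarrow> close (graph_coprod I G) (i, a) (i, a')"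
  by (auto simp: close_def graph_coprod_def)

definition disk_sum :: "nat \<Rightarrow> ((nat \<times> nat) + nat) graph" where
  "disk_sum k = graph_sum (box_product (cycle_graph k) (path_graph 3)) (path_graph 0)"

definition disk_gluing :: "nat \<Rightarrow> (((nat \<times> nat) + nat) \<times> ((nat \<times> nat) + nat)) set" where
  "disk_gluing k = gluing (box_product (cycle_graph k) (path_graph 0)) (\<lambda>(y, t). (y, t)) (\<lambda>_. 0)"

abbreviation "disk_map k \<equiv> quotient_map (disk_sum k) (disk_gluing k)"

definition wedge_sum :: "nat \<Rightarrow> ((nat \<times> nat) + nat) graph" where
  "wedge_sum m = graph_sum (graph_coprod {1..m} (\<lambda>_. cycle_graph 5)) (path_graph 0)"

definition wedge_gluing :: "nat \<Rightarrow> (((nat \<times> nat) + nat) \<times> ((nat \<times> nat) + nat)) set" where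
  "wedge_gluing m = gluing (graph_coprod {1..m} (\<lambda>_. path_graph 0)) (\<lambda>(i, t). (i, t)) (\<lambda>_. 0)"

abbreviation "wedge_map m \<equiv> quotient_map (wedge_sum m) (wedge_gluing m)"

lemma disk_eq: "disk k 3 = quotient_graph (disk_sum k) (disk_gluing k)"
  by (simp add: disk_def cone_def pushout_def disk_sum_def disk_gluing_def)

lemma disk_boundary_eq: "disk_boundary k 3 v = disk_map k (Inl (v, 3))"
  by (simp add: disk_boundary_def cone_vertex_def pushout_left_def disk_sum_def disk_gluing_def)

lemma wedge_eq: "wedge m = quotient_graph (wedge_sum m) (wedge_gluing m)"
  by (simp add: wedge_def pushout_def wedge_sum_def wedge_gluing_def)

lemma wedge_vertex_eq: "wedge_vertex m i t = wedge_map m (Inl (i, t))"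
  by (simp add: wedge_vertex_def pushout_left_def wedge_sum_def wedge_gluing_def)

lemma disk_gluing_iff: "(a, b) \<in> disk_gluing k \<longleftrightarrow> (\<exists>v<k. a = Inl (v, 0) \<and> b = Inr 0)"
  by (auto simp: disk_gluing_def gluing_def box_product_def cycle_graph_def path_graph_def)

lemma wedge_gluing_iff: "(a, b) \<in> wedge_gluing m \<longleftrightarrow> (\<exists>i\<in>{1..m}. a = Inl (i, 0) \<and> b = Inr 0)"
  by (auto simp: wedge_gluing_def gluing_def graph_coprod_def path_graph_def)

lemma verts_disk_sum: "x \<in> verts (disk_sum k) \<longleftrightarrow> (\<exists>v<k. \<exists>s\<le>3. x = Inl (v, s)) \<or> x = Inr 0"
  by (auto simp: disk_sum_def graph_sum_def box_product_def cycle_graph_def path_graph_def)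

lemma verts_wedge_sum: "x \<in> verts (wedge_sum m) \<longleftrightarrow> (\<exists>i\<in>{1..m}. \<exists>t<5. x = Inl (i, t)) \<or> x = Inr 0"
  by (auto simp: wedge_sum_def graph_sum_def graph_coprod_def cycle_graph_def path_graph_def)

lemma disk_map_apex: "v < k \<Longrightarrow> disk_map k (Inl (v, 0)) = disk_map k (Inr 0)"
  by (subst quotient_map_eq_iff)
    (auto simp: verts_disk_sum disk_gluing_iff intro!: r_into_equivclp)

lemma wedge_map_base: "i \<in> {1..m} \<Longrightarrow> wedge_map m (Inl (i, 0)) = wedge_map m (Inr 0)"
  by (subst quotient_map_eq_iff)
    (auto simp: verts_wedge_sum wedge_gluing_iff intro!: r_into_equivclp)

lemma close_disk_ring:
  assumes "v < k" "s \<le> 3"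
  shows "close (disk k 3) (disk_map k (Inl (v, s))) (disk_map k (Inl (Suc v mod k, s)))"
  unfolding disk_eq disk_sum_def
  by (intro close_quotient_graph close_graph_sum)
    (use assms in \<open>auto simp: close_def box_product_def cycle_graph_def path_graph_def\<close>)

lemma close_disk_spoke:
  assumes "v < k" "s < 3"
  shows "close (disk k 3) (disk_map k (Inl (v, s))) (disk_map k (Inl (v, Suc s)))"
  unfolding disk_eq disk_sum_def
  by (intro close_quotient_graph close_graph_sum)
    (use assms in \<open>auto simp: close_def box_product_def cycle_graph_def path_graph_def\<close>)

lemma close_wedge:
  assumes "i \<in> {1..m}" "t < 5"
  shows "close (wedge m) (wedge_vertex m i t) (wedge_vertex m i (Suc t mod 5))"
  unfolding wedge_eq wedge_vertex_eq wedge_sum_def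
  by (intro close_quotient_graph close_graph_sum close_graph_coprod)
    (use assms in \<open>auto simp: close_def cycle_graph_def\<close>)

text \<open>The collapsed vertex contributes no edge, so every edge of the disk comes from the prism
  over the cycle.\<close>

lemma adj_diskE:
  assumes "(d, d') \<in> adj (disk k 3)"
  obtains v s v' s' where "d = disk_map k (Inl (v, s))" "d' = disk_map k (Inl (v', s'))"
    "v < k" "v' < k" "s \<le> 3" "s' \<le> 3"
    "(v' = Suc v mod k \<or> v = Suc v' mod k) \<and> s = s' \<or> v = v' \<and> (s' = Suc s \<or> s = Suc s')"
proof -
  obtain u u' where u: "(u, u') \<in> adj (disk_sum k)" "d = disk_map k u" "d' = disk_map k u'"
    using assms unfolding disk_eq by (auto simp: quotient_graph_def)
  obtain v s v' s' where "u = Inl (v, s)" "u' = Inl (v', s')"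
    "((v, s), (v', s')) \<in> adj (box_product (cycle_graph k) (path_graph 3))"
    using u(1) by (auto simp: disk_sum_def graph_sum_def path_graph_def)
  with u(2,3) show ?thesis
    by (intro that[of v s v' s']) (auto simp: box_product_def cycle_graph_def path_graph_def)
qed

lemma adj_wedgeE:
  assumes "(d, d') \<in> adj (wedge m)"
  obtains i t t' where "d = wedge_vertex m i t" "d' = wedge_vertex m i t'"
    "i \<in> {1..m}" "t < 5" "t' < 5" "t' = Suc t mod 5 \<or> t = Suc t' mod 5"
proof -
  obtain u u' where u: "(u, u') \<in> adj (wedge_sum m)" "d = wedge_map m u" "d' = wedge_map m u'"
    using assms unfolding wedge_eq by (auto simp: quotient_graph_def)
  obtain i t t' where "u = Inl (i, t)" "u' = Inl (i, t')" "i \<in> {1..m}" "(t, t') \<in> adj (cycle_graph 5)"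
    using u(1) by (auto simp: wedge_sum_def graph_sum_def graph_coprod_def path_graph_def)
  with u(2,3) show ?thesis
    by (intro that[of i t t']) (auto simp: wedge_vertex_eq cycle_graph_def)
qed

context presentation
begin

definition XG :: "((nat \<times> ((nat \<times> nat) + nat) set) + ((nat \<times> nat) + nat) set) graph" where
  "XG = graph_sum (graph_coprod {1..n} (\<lambda>j. disk (len j) 3)) (wedge m)"

definition XR :: "(((nat \<times> ((nat \<times> nat) + nat) set) + ((nat \<times> nat) + nat) set) \<times>
    ((nat \<times> ((nat \<times> nat) + nat) set) + ((nat \<times> nat) + nat) set)) set" where
  "XR = gluing (graph_coprod {1..n} (\<lambda>j. cycle_graph (len j)))
     (\<lambda>(j, v). (j, disk_boundary (len j) 3 v)) (\<lambda>(j, v). wrap m (r j) v)"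

abbreviation "X \<equiv> presentation_graph m n r"
abbreviation "qX \<equiv> quotient_map XG XR"

lemma X_eq: "X = quotient_graph XG XR"
  by (simp add: presentation_graph_def pushout_def XG_def XR_def len_def)

lemma simple_X: "simple_graph X"
  using deg by (rule simple_graph_presentation_graph)

lemma XR_iff: "(a, b) \<in> XR \<longleftrightarrow>
    (\<exists>j\<in>{1..n}. \<exists>v<len j. a = Inl (j, disk_map (len j) (Inl (v, 3))) \<and> b = Inr (wrap m (r j) v))"
  by (auto simp: XR_def gluing_def graph_coprod_def cycle_graph_def disk_boundary_eq)

fun disk_coord :: "nat \<Rightarrow> (nat \<times> nat) + nat \<Rightarrow> vtx" where
  "disk_coord j (Inl (v, s)) = (if s = 0 then Apex j else if s = 3 then attach j v else Ring j v s)"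
| "disk_coord j (Inr _) = Apex j"

fun wedge_coord :: "(nat \<times> nat) + nat \<Rightarrow> vtx" where
  "wedge_coord (Inl (i, t)) = circle_vtx i t"
| "wedge_coord (Inr _) = Base"

text \<open>The nested quotients are undone one at a time: here the inner ones, forming the disks
  and the wedge; the outer gluing is left to a second lift.\<close>

fun coord0 :: "(nat \<times> ((nat \<times> nat) + nat) set) + ((nat \<times> nat) + nat) set \<Rightarrow> vtx" where
  "coord0 (Inl (j, d)) = quotient_lift (disk_coord j) d"
| "coord0 (Inr w) = quotient_lift wedge_coord w"

declare coord0.simps [simp del]

fun rep :: "vtx \<Rightarrow> (nat \<times> ((nat \<times> nat) + nat) set) + ((nat \<times> nat) + nat) set" where
  "rep Base = Inr (wedge_map m (Inr 0))"
| "rep (Circ i t) = Inr (wedge_vertex m i t)"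
| "rep (Ring j v s) = Inl (j, disk_map (len j) (Inl (v, s)))"
| "rep (Apex j) = Inl (j, disk_map (len j) (Inr 0))"

lemma coord0_disk [simp]:
  "v < len j \<Longrightarrow> s \<le> 3 \<Longrightarrow> coord0 (Inl (j, disk_map (len j) (Inl (v, s)))) = disk_coord j (Inl (v, s))"
  "coord0 (Inl (j, disk_map (len j) (Inr 0))) = Apex j"
  unfolding coord0.simps
  by (subst quotient_lift_map; auto simp: verts_disk_sum disk_gluing_iff)+

lemma coord0_wedge [simp]:
  "i \<in> {1..m} \<Longrightarrow> t < 5 \<Longrightarrow> coord0 (Inr (wedge_vertex m i t)) = circle_vtx i t"
  "coord0 (Inr (wedge_map m (Inr 0))) = Base"
  unfolding coord0.simps wedge_vertex_eq
  by (subst quotient_lift_map; auto simp: verts_wedge_sum wedge_gluing_iff circle_vtx_def)+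

lemma rep_circle_vtx: "i \<in> {1..m} \<Longrightarrow> rep (circle_vtx i t) = Inr (wedge_vertex m i t)"
  by (simp add: circle_vtx_def wedge_map_base wedge_vertex_eq)

lemma rep_attach:
  assumes "j \<in> {1..n}" "v < len j"
  shows "rep (attach j v) = Inr (wrap m (r j) v)" "coord0 (Inr (wrap m (r j) v)) = attach j v"
proof -
  have "v div 5 < word_degree (r j)" using assms(2) by (auto simp: len_def)
  then obtain a e where a: "letters (r j) ! (v div 5) = (a, e)" "a \<in> {1..m}"
    using letter_nth[OF assms(1)] by metis
  have "nat ((e * int (v mod 5)) mod 5) < 5" by (simp add: nat_less_iff)
  then show "rep (attach j v) = Inr (wrap m (r j) v)" "coord0 (Inr (wrap m (r j) v)) = attach j v"
    using a by (simp_all add: attach_def wrap_def rep_circle_vtx)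
qed

text \<open>A vertex with \<open>s = 3\<close> was given the coordinate of the wedge vertex to which
  it is attached.\<close>

lemma coord0_respects: "(a, b) \<in> XR \<Longrightarrow> coord0 a = coord0 b"
  by (auto simp: XR_iff rep_attach)

lemma verts_XG_E:
  assumes "u \<in> verts XG"
  obtains j v s where "j \<in> {1..n}" "v < len j" "s \<le> 3" "u = Inl (j, disk_map (len j) (Inl (v, s)))"
  | j where "j \<in> {1..n}" "u = Inl (j, disk_map (len j) (Inr 0))"
  | i t where "i \<in> {1..m}" "t < 5" "u = Inr (wedge_vertex m i t)"
  | "u = Inr (wedge_map m (Inr 0))"
proof (cases u)
  case (Inl jd)
  obtain j d where jd: "jd = (j, d)" by (cases jd)
  then have j: "j \<in> {1..n}" "d \<in> verts (disk (len j) 3)"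
    using assms Inl by (auto simp: XG_def graph_sum_def graph_coprod_def)
  from j(2) obtain z where "z \<in> verts (disk_sum (len j))" "d = disk_map (len j) z"
    unfolding disk_eq by (rule quotient_graph_vertE)
  then show ?thesis using that(1,2) j Inl jd by (auto simp: verts_disk_sum)
next
  case (Inr w)
  then have "w \<in> verts (wedge m)" using assms by (auto simp: XG_def graph_sum_def)
  then obtain z where "z \<in> verts (wedge_sum m)" "w = wedge_map m z"
    unfolding wedge_eq by (rule quotient_graph_vertE)
  then show ?thesis using that(3,4) Inr by (auto simp: verts_wedge_sum wedge_vertex_eq)
qed

lemma verts_XG_I:
  "j \<in> {1..n} \<Longrightarrow> v < len j \<Longrightarrow> s \<le> 3 \<Longrightarrow> Inl (j, disk_map (len j) (Inl (v, s))) \<in> verts XG"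
  "j \<in> {1..n} \<Longrightarrow> Inl (j, disk_map (len j) (Inr 0)) \<in> verts XG"
  "i \<in> {1..m} \<Longrightarrow> t < 5 \<Longrightarrow> Inr (wedge_vertex m i t) \<in> verts XG"
  "Inr (wedge_map m (Inr 0)) \<in> verts XG"
proof -
  have d: "disk_map (len j) z \<in> verts (disk (len j) 3)" if "z \<in> verts (disk_sum (len j))" for z j
    unfolding disk_eq using that by (rule quotient_map_in)
  have w: "wedge_map m z \<in> verts (wedge m)" if "z \<in> verts (wedge_sum m)" for z
    unfolding wedge_eq using that by (rule quotient_map_in)
  show "j \<in> {1..n} \<Longrightarrow> v < len j \<Longrightarrow> s \<le> 3 \<Longrightarrow> Inl (j, disk_map (len j) (Inl (v, s))) \<in> verts XG"
    "j \<in> {1..n} \<Longrightarrow> Inl (j, disk_map (len j) (Inr 0)) \<in> verts XG"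
    using d by (auto simp: XG_def graph_sum_def graph_coprod_def verts_disk_sum)
  show "i \<in> {1..m} \<Longrightarrow> t < 5 \<Longrightarrow> Inr (wedge_vertex m i t) \<in> verts XG"
    "Inr (wedge_map m (Inr 0)) \<in> verts XG"
    using w by (auto simp: XG_def graph_sum_def wedge_vertex_eq verts_wedge_sum)
qed

lemma rep_K:
  assumes "y \<in> verts K" shows "rep y \<in> verts XG" "coord0 (rep y) = y"
proof -
  have "rep y \<in> verts XG \<and> coord0 (rep y) = y"
  proof (cases y)
    case (Circ i t)
    then have "i \<in> {1..m}" "t < 5" "t \<noteq> 0" using assms by auto
    then show ?thesis using Circ verts_XG_I(3) by (simp add: circle_vtx_def)
  next
    case (Ring j v s)
    then have "j \<in> {1..n}" "v < len j" "s \<le> 3" "s \<noteq> 0" "s \<noteq> 3" using assms by auto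
    then show ?thesis using Ring verts_XG_I(1) by simp
  qed (use assms verts_XG_I in auto)
  then show "rep y \<in> verts XG" "coord0 (rep y) = y" by auto
qed

lemma coord0_XG:
  assumes "u \<in> verts XG" shows "coord0 u \<in> verts K" "qX (rep (coord0 u)) = qX u"
proof -
  have "coord0 u \<in> verts K \<and> qX (rep (coord0 u)) = qX u"
  proof (rule verts_XG_E[OF assms])
    fix j v s assume u: "j \<in> {1..n}" "v < len j" "s \<le> 3" "u = Inl (j, disk_map (len j) (Inl (v, s)))"
    consider "s = 0" | "s = 1" | "s = 2" | "s = 3" using u(3) by linarith
    then show ?thesis
    proof cases
      \<comment> \<open>Only for \<open>s = 3\<close> does \<open>rep (coord0 u)\<close> differ from
        \<open>u\<close>: it lies in the wedge and is identified with \<open>u\<close> by the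
        gluing.\<close>
      case 4
      have "equivclp (\<lambda>a b. (a, b) \<in> XR) (Inr (wrap m (r j) v)) u"
        using u 4 by (intro equivclp_sym[OF r_into_equivclp]) (auto simp: XR_iff)
      moreover have "Inr (wrap m (r j) v) \<in> verts XG"
        using rep_K(1)[OF attach_verts[OF u(1,2)]] rep_attach[OF u(1,2)] by simp
      ultimately show ?thesis
        using u 4 assms by (simp add: rep_attach attach_verts quotient_map_eq_iff)
    qed (use u in \<open>auto simp: disk_map_apex\<close>)
  qed (auto simp: rep_circle_vtx circle_vtx_verts)
  then show "coord0 u \<in> verts K" "qX (rep (coord0 u)) = qX u" by auto
qed

lemma coord0_adj:
  assumes "(u, v) \<in> adj XG" shows "close K (coord0 u) (coord0 v)"
proof -
  consider (d) j d d' where "j \<in> {1..n}" "(d, d') \<in> adj (disk (len j) 3)" "u = Inl (j, d)" "v = Inl (j, d')"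
    | (w) w w' where "(w, w') \<in> adj (wedge m)" "u = Inr w" "v = Inr w'"
    using assms by (auto simp: XG_def graph_sum_def graph_coprod_def)
  then show ?thesis
  proof cases
    case (d j d d')
    obtain v1 s v2 s' where e: "d = disk_map (len j) (Inl (v1, s))" "d' = disk_map (len j) (Inl (v2, s'))"
      "v1 < len j" "v2 < len j" "s \<le> 3" "s' \<le> 3"
      "(v2 = Suc v1 mod len j \<or> v1 = Suc v2 mod len j) \<and> s = s' \<or> v1 = v2 \<and> (s' = Suc s \<or> s = Suc s')"
      by (rule adj_diskE[OF d(2)])
    \<comment> \<open>For \<open>s = 0\<close> the ring collapses to the apex, and for
      \<open>s = 3\<close> it follows the attaching map through the wedge.\<close>
    have ring: "close K (disk_coord j (Inl (v, s))) (disk_coord j (Inl (Suc v mod len j, s)))"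
      if "v < len j" "s \<le> 3" for v s
      using that d(1) close_attach_step[of j v] by (cases "s = 3"; cases "s = 0") (auto simp: close_K)
    have spoke: "close K (disk_coord j (Inl (v, s))) (disk_coord j (Inl (v, Suc s)))"
      if "v < len j" "Suc s \<le> 3" for v s
    proof -
      have "s = 0 \<or> s = 1 \<or> s = 2" using that(2) by linarith
      then show ?thesis using that d(1) arc_glue[of j v] by (auto simp: close_K)
    qed
    from e(7) have "close K (disk_coord j (Inl (v1, s))) (disk_coord j (Inl (v2, s')))"
      using ring[OF e(3,5)] close_sym[OF simple_K ring[OF e(4,6)]]
        spoke[OF e(3), of s] close_sym[OF simple_K spoke[OF e(4), of s']] e(5,6)
      by (elim conjE disjE; simp only:)
    then show ?thesis using e d by simp
  next
    case (w w w')
    obtain i t t' where "w = wedge_vertex m i t" "w' = wedge_vertex m i t'"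
      "i \<in> {1..m}" "t < 5" "t' < 5" "t' = Suc t mod 5 \<or> t = Suc t' mod 5"
      by (rule adj_wedgeE[OF w(1)])
    then show ?thesis using w arc_circle_vtx[of i] by (auto simp: close_K)
  qed
qed

text \<open>The lifted edge need not join \<open>rep y\<close> to \<open>rep y'\<close>: an arc from
  a ring into the wedge lifts to a spoke ending at \<open>s = 3\<close>, inside the disk.\<close>

lemma arc_lift:
  assumes "arc y y'"
  obtains u v where "close XG u v" "u \<in> verts XG" "v \<in> verts XG" "coord0 u = y" "coord0 v = y'"
proof -
  note I = that
  have disk: "close XG (Inl (j, d)) (Inl (j, d'))" if "j \<in> {1..n}" "close (disk (len j) 3) d d'" for j d d'
    using that unfolding XG_def by (intro close_graph_sum close_graph_coprod)
  have wedge: thesis if y: "i \<in> {1..m}" "t < 5" "y = circle_vtx i t" "y' = circle_vtx i (Suc t mod 5)" for i t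
    by (rule I[of "Inr (wedge_vertex m i t)" "Inr (wedge_vertex m i (Suc t mod 5))"])
      (use y close_wedge verts_XG_I in \<open>auto simp: XG_def intro!: close_graph_sum\<close>)
  have ring: thesis if y: "j \<in> {1..n}" "v < len j" "s \<in> {1, 2}" "y = Ring j v s" "y' = Ring j (Suc v mod len j) s" for j v s
    by (rule I[of "Inl (j, disk_map (len j) (Inl (v, s)))" "Inl (j, disk_map (len j) (Inl (Suc v mod len j, s)))"])
      (use y verts_XG_I len_pos[OF y(1)] in \<open>auto intro!: close_disk_ring disk\<close>)
  have spoke: thesis if y: "j \<in> {1..n}" "v < len j" "s < 3" "y = disk_coord j (Inl (v, s))" "y' = disk_coord j (Inl (v, Suc s))" for j v s
    by (rule I[of "Inl (j, disk_map (len j) (Inl (v, s)))" "Inl (j, disk_map (len j) (Inl (v, Suc s)))"])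
      (use y verts_XG_I in \<open>auto intro!: close_disk_spoke disk\<close>)
  show thesis
  proof (cases y)
    case Base
    then show ?thesis using assms wedge[of _ 0] by (cases y') (auto simp: circle_vtx_def)
  next
    case (Circ i t)
    then show ?thesis using assms wedge[of i t] by (cases y') (auto simp: circle_vtx_def)
  next
    case (Ring j v s)
    show ?thesis
    proof (cases "in_wedge y'")
      case True
      then show ?thesis using Ring assms spoke[of j v 2] by (cases y') auto
    next
      case False
      then show ?thesis using Ring assms spoke[of j v 1] ring[of j v s] by (cases y') (auto simp: numeral_2_eq_2)
    qed
  next
    case (Apex j)
    then show ?thesis using assms spoke[of j _ 0] by (cases y') auto
  qed
qed

section \<open>The isomorphism with the model\<close>

definition coord where "coord = quotient_lift coord0"
definition point where "point y = qX (rep y)"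

lemma coord_qX: "u \<in> verts XG \<Longrightarrow> coord (qX u) = coord0 u"
  unfolding coord_def by (rule quotient_lift_map) (auto simp: coord0_respects)

lemma point_coord0: "u \<in> verts XG \<Longrightarrow> point (coord0 u) = qX u"
  by (simp add: point_def coord0_XG)

lemma simple_XG: "simple_graph XG"
  unfolding XG_def
proof (intro simple_graph_sum simple_graph_coprod simple_graph_wedge)
  fix j assume "j \<in> {1..n}"
  with len_ge[of j] show "simple_graph (disk (len j) 3)"
    by (simp add: disk_def cone_def simple_graph_pushout simple_graph_box simple_graph_path
        simple_graph_cycle)
qed

lemma close_coord:
  assumes "close X c d" shows "close K (coord c) (coord d)"
proof (cases "c = d")
  case False
  then obtain u v where uv: "(u, v) \<in> adj XG" "c = qX u" "d = qX v"
    using assms by (auto simp: close_def X_eq quotient_graph_def)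
  then have "u \<in> verts XG" "v \<in> verts XG" using simple_XG by (auto simp: simple_graph_def)
  then show ?thesis using coord0_adj[OF uv(1)] uv by (simp add: coord_qX)
qed simp

lemma close_point:
  assumes "close K y y'" shows "close X (point y) (point y')"
proof -
  have *: "close X (point a) (point b)" if "arc a b" for a b
  proof (rule arc_lift[OF that])
    fix u v assume uv: "close XG u v" "u \<in> verts XG" "v \<in> verts XG" "coord0 u = a" "coord0 v = b"
    have "close X (qX u) (qX v)" unfolding X_eq using uv(1) by (rule close_quotient_graph)
    then show ?thesis
      unfolding uv(4,5)[symmetric] point_coord0[OF uv(2)] point_coord0[OF uv(3)] .
  qed
  then show ?thesis using assms close_sym[OF simple_X] by (auto simp: close_K)
qed

theorem A1_presentation_graph:
  assumes "x \<in> verts X"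
  shows "group (A1 X x) \<and> A1 X x \<cong> H"
proof (rule K.A1_iso_transport[OF simple_X assms, where F = coord and h = point])
  show F: "coord c \<in> verts K" if "c \<in> verts X" for c
    using that unfolding X_eq by (auto elim!: quotient_graph_vertE simp: coord_qX coord0_XG)
  show "point (coord c) = c" if "c \<in> verts X" for c
    using that unfolding X_eq by (auto elim!: quotient_graph_vertE simp: coord_qX point_coord0)
  show "point a \<in> verts X" if "a \<in> verts K" for a
    using that unfolding X_eq point_def by (intro quotient_map_in rep_K)
  show "coord (point a) = a" if "a \<in> verts K" for a
    using that by (simp add: point_def coord_qX rep_K)
  show "carrier H \<subseteq> hol H (\<lambda>a b. cl (label a b)) ` loops K (coord x)"
    using hol_surj[OF F[OF assms]] by blast
  show "htpy K p q" if "p \<in> loops K (coord x)" "q \<in> loops K (coord x)"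
    "hol H (\<lambda>a b. cl (label a b)) p = hol H (\<lambda>a b. cl (label a b)) q" for p q
    using that by (intro htpy_if_hol_eq) (auto simp: loops_def)
qed (fact close_coord close_point)+

end

theorem theorem6p5:
  fixes G :: "('g, 'h) monoid_scheme" and m n :: nat and r :: "nat \<Rightarrow> gen_word"
  assumes "group G"
    and "\<And>j. j \<in> {1..n} \<Longrightarrow> word_over m (r j)"
    and "\<And>j. j \<in> {1..n} \<Longrightarrow> word_degree (r j) \<ge> 1"
    and "G \<cong> presented_group m n r"
    and "x \<in> verts (presentation_graph m n r)"
  shows "group (A1 (presentation_graph m n r) x) \<and> A1 (presentation_graph m n r) x \<cong> G"
proof -
  interpret presentation m n r using assms(2,3) by unfold_locales
  have "presented_group m n r \<cong> G" using group.iso_sym[OF assms(1,4)] .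
  then show ?thesis using A1_presentation_graph[OF assms(5)] iso_trans by blast
qed

end
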